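(* Consider problem (P) under the standing assumptions of the context, and let $\{x^k\}$ be generated by the algorithm sESQM described in the context. Suppose that: (CQ) $0\notin \partial g(x)+\mathcal{N}_{\mathcal{C}}(x)$ for every $x\in\mathcal{C}$ with $g(x)\ge 0$; (Parameters) $\{\mu_k\}$ is positive and nonincreasing, $\lim_{k\to\infty}\mu_k=0$, and $S_K:=\sum_{k=\lceil K/2\rceil}^{K}\mu_k\to\infty$ as $K\to\infty$; moreover $\lim_{k\to\infty}\widehat\gamma_k=0$ and there is $M_{\widehat\gamma}>1$ with $0<\widehat\gamma_{k+1}<\widehat\gamma_k\le M_{\widehat\gamma}\widehat\gamma_{k+1}$ for all $k\in\mathbb{N}_0$. Let $M_1,\eta_\gamma,M_{\bar t},M_2,M_3$ be as defined in the context. Let $\epsilon_1>0$, $\epsilon_2>0$ and an integer $K\ge2M_{\bar t}$ satisfy $$S_K^{-1}\le M_2^{-1}\eta_\gamma^2\min\{c_2^2,\ M_1^{-2}\epsilon_1^2\},$$ $$\mu_{\lceil K/2\rceil-M_{\bar t}}\le M_4\epsilon_2,\qquad M_4:=\min\left\{\frac1{\alpha_3^h},\ \frac1{M_3},\ \frac{M_1}{\eta_\gamma},\ \frac1{3\alpha_3^\varphi+[\alpha_{3,1}^h]_+}\right\}.$$ Then there exists an integer $\hat k\in[\lceil K/2\rceil-M_{\bar t},K]$ such that $x^{\hat k+1}$ is an $(\epsilon_1,\epsilon_2)$-KKT point of (P).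
   Context: **Notation.** $\mathbb{N}_0=\{0,1,2,\dots\}$; $[s]_+=\max\{s,0\}$; $\phi^+=\max\{\phi,0\}$; $\delta_{\mathcal{C}}$ is the indicator function (0 on $\mathcal{C}$, $+\infty$ off it); $\mathcal{N}_{\mathcal{C}}=\partial\delta_{\mathcal{C}}$ is the normal cone; $\partial_\epsilon\phi(x)=\{\xi:\phi(z)\ge\phi(x)+\langle\xi,z-x\rangle-\epsilon\ \forall z\}$ for convex $\phi$; $\partial$ is the limiting subdifferential (the usual one for convex functions); in the present setting $\partial g(x)=Dc(x)^*\partial h(c(x))$. "$L$-smooth on $\mathcal{C}$" means the derivative is $L$-Lipschitz on $\mathcal{C}$. $Dc(x)^*$ is the adjoint of the derivative. **Problem (P).** $\mathbb{X},\mathbb{Y}$ are finite-dimensional real Hilbert spaces: $$\min_{x\in\mathbb{X}}\ \psi(x):=f(x)+P_1(x)-P_2(x)+\delta_{\mathcal{C}}(x)\quad\text{s.t.}\quad g(x):=h(c(x))\le 0.$$ Standing assumptions: (i) $\mathcal{C}\subseteq\mathbb{X}$ is compact and convex and $\mathcal{F}:=\{x\in\mathcal{C}:g(x)\le0\}\ne\emptyset$; (ii) $f:\mathbb{X}\to\mathbb{R}$ and $c:\mathbb{X}\to\mathbb{Y}$ are continuously differentiable, $L_f$-smooth and $L_c$-smooth on $\mathcal{C}$ respectively ($L_f>0$, $L_c\ge0$), and $c$ is $M_c$-Lipschitz on $\mathcal{C}$ with $M_c>0$; (iii) $P_1,P_2:\mathbb{X}\to\mathbb{R}$ are convex; (iv)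 $h:\mathbb{Y}\to\mathbb{R}$ is convex and $M_h$-Lipschitz with $M_h>0$. **$(\epsilon_1,\epsilon_2)$-KKT point.** For $\epsilon_1,\epsilon_2\ge0$, $x\in\mathcal{C}$ is an $(\epsilon_1,\epsilon_2)$-KKT point of (P) if there exist $z\in\mathcal{C}$, $u\in\mathbb{Y}$ and $\lambda\ge0$ such that $\mathrm{dist}(0,\nabla f(x)+\partial P_1(x)-\partial P_2(z)+\lambda Dc(x)^*u+\mathcal{N}_{\mathcal{C}}(x))\le\epsilon_1$, $g(x)\le\epsilon_2$, $u\in\partial_{\epsilon_2}h(c(x))$, $|\lambda g(x)|\le\epsilon_2$ and $\|x-z\|\le\epsilon_1\epsilon_2$. **Smoothing.** A family of convex $C^1$ functions $\{\phi_\mu\}_{\mu>0}$ is a smoothing approximation (SA) of a convex $\phi:\mathbb{Y}\to\mathbb{R}$ with parameters $(\alpha_1^\phi,\alpha_2^\phi,\alpha_{3,1}^\phi,\alpha_{3,2}^\phi)$, where $\alpha_1^\phi\ge0$, $\alpha_2^\phi>0$, $\alpha_{3,1}^\phi,\alpha_{3,2}^\phi\in\mathbb{R}$ and $\alpha_3^\phi:=\alpha_{3,1}^\phi+\alpha_{3,2}^\phi>0$, if for all $\mu>0$: $\nabla\phi_\mu$ is $(\alpha_1^\phi+\alpha_2^\phi/\mu)$-Lipschitz and $\phi-\alpha_{3,1}^\phi\mu\le\phi_\mu\le\phi+\alpha_{3,2}^\phi\mu$ pointwise. Fixed throughout: an SA $\{h_\mu\}$ of $h$ with parameters $(\alpha_1^h,\alpha_2^h,\alpha_{3,1}^h,\alpha_{3,2}^h)$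 and a constant $\alpha_4^h\ge0$ with $h_{\mu_1}(y)\le h_{\mu_0}(y)+\alpha_4^h(\mu_0-\mu_1)$ for all $\mu_0\ge\mu_1>0$, $y\in\mathbb{Y}$; and an SA $\{\varphi_\mu\}$ of $[\cdot]_+:\mathbb{R}\to\mathbb{R}$ with parameters $(\alpha_1^\varphi,\alpha_2^\varphi,\alpha_{3,1}^\varphi,\alpha_{3,2}^\varphi)$ and a constant $\alpha_4^\varphi\ge0$ with $\varphi_{\mu_1}(s)\le\varphi_{\mu_0}(s)+\alpha_4^\varphi(\mu_0-\mu_1)$ for all $\mu_0\ge\mu_1>0$, $s\in\mathbb{R}$. Set $H_\mu:=\varphi_\mu\circ h_\mu$, $g_\mu:=H_\mu\circ c$, $\alpha_1=\alpha_1^h+M_h^2\alpha_1^\varphi$, $\alpha_2=\alpha_2^h+M_h^2\alpha_2^\varphi$, $\alpha_{3,1}=[\alpha_{3,1}^h]_++\alpha_{3,1}^\varphi$, $\alpha_4=\alpha_4^h+\alpha_4^\varphi$, and $L_\mu:=M_hL_c+\alpha_1M_c^2+\alpha_2M_c^2/\mu$. **Algorithm sESQM.** Inputs: $x^0\in\mathcal{C}$, $\mu_0>0$, $\overline L\ge\underline L>0$, $c_1>0$, $c_2>0$, a strictly decreasing positive sequence $\{\widehat\gamma_k\}$, and the SAs above. Set $t_0=0$. For $k=0,1,2,\dots$: Step 1: take $\xi^k\in\partial P_2(x^k)$, $L_{k,0}\in[\underline L,\overline L]$; set $\gamma_k=\widehat\gamma_{t_k}$, $\widetilde L=L_{k,0}$.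 Step 2: compute $\widetilde x=\arg\min_{x\in\mathbb{X}}\{\gamma_k(\langle\nabla f(x^k)-\xi^k,x\rangle+P_1(x))+\ell_k(x)+\frac{\widetilde L}{2\mu_k}\|x-x^k\|^2+\delta_{\mathcal{C}}(x)\}$ with $\ell_k(x):=g_{\mu_k}(x^k)+\langle\nabla g_{\mu_k}(x^k),x-x^k\rangle$. Step 3: if $\gamma_k\psi(\widetilde x)+g_{\mu_k}(\widetilde x)\le\gamma_k\psi(x^k)+g_{\mu_k}(x^k)-\frac{c_1}{2\mu_k}\|\widetilde x-x^k\|^2$ go to Step 4; otherwise replace $\widetilde L$ by $2\widetilde L$ and go to Step 2. Step 4: set $x^{k+1}=\widetilde x$, $L_k=\widetilde L$. If $h_{\mu_k}(c(x^{k+1}))>2\alpha_3^\varphi\mu_k$ and $\|x^{k+1}-x^k\|\le c_2\mu_k\gamma_k$, set $t_{k+1}=t_k+1$; otherwise $t_{k+1}=t_k$. Step 5: choose $\mu_{k+1}\in(0,\mu_k]$. **Constants.** $M_L:=\max\{\overline L,\ c_1+\gamma_0\mu_0L_f+\mu_0L_{\mu_0}\}$; $M_f:=\sup_{x\in\mathcal{C}}\|\nabla f(x)\|$; $M_{P_i}:=\sup\{\|\xi\|:\xi\in\partial P_i(x),x\in\mathcal{C}\}$, $i=1,2$; $M_1:=M_L+\mu_0\widehat\gamma_0L_f+\mu_0L_{\mu_0}$. $\eta_1>0$ is a constant (which exists under the standing assumptions and (CQ)) such that $\mathrm{dist}(0,Dc(x)^*u+\mathcal{N}_{\mathcal{C}}(x))\ge\eta_1$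 for every $x\in\mathcal{C}$ with $g(x)\ge-\eta_1$ and every $u\in\partial_{\eta_1}h(c(x))$. With $k_0:=\min\{k\in\mathbb{N}_0:\mu_k\le\eta_1/\max\{\alpha_3^h,[\alpha_{3,2}^h]_+\}\}$, $$\eta_\gamma:=\min\left\{\frac{\eta_1}{2M_{\widehat\gamma}(M_f+M_{P_1}+M_{P_2}+c_2(M_L+\mu_0L_{\mu_0}))},\widehat\gamma_{k_0+1}\right\},\qquad M_{\bar t}:=\max\{t\in\mathbb{N}_0:\widehat\gamma_t\ge\eta_\gamma\}.$$ $M_2:=1+2(M_{\bar t}+1)(Q_0+[\alpha_{3,1}]_+\mu_0)/c_1$ with $Q_0:=\gamma_0(\psi(x^0)-\bar m)+g_{\mu_0}(x^0)+\alpha_4\mu_0$, $\bar m:=\inf_{x\in\mathbb{X}}\psi(x)$; $M_3:=(3\alpha_3^\varphi+[\alpha_{3,1}^h]_++[\alpha_{3,2}^h]_+)/\eta_\gamma$. *)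

theory Defs
  imports "HOL-Analysis.Analysis"
begin

section \<open>Derivatives\<close>

definition Df :: "('a::real_normed_vector \<Rightarrow> 'b::real_normed_vector) \<Rightarrow> 'a \<Rightarrow> 'a \<Rightarrow>\<^sub>L 'b" where
  "Df F x = Blinfun (frechet_derivative F (at x))"

definition cont_diff :: "('a::real_normed_vector \<Rightarrow> 'b::real_normed_vector) \<Rightarrow> bool" where
  "cont_diff F \<longleftrightarrow> (\<forall>x. F differentiable (at x)) \<and> continuous_on UNIV (Df F)"

definition Df_adj :: "('a::real_inner \<Rightarrow> 'b::real_inner) \<Rightarrow> 'a \<Rightarrow> 'b \<Rightarrow> 'a" where
  "Df_adj F x = adjoint (blinfun_apply (Df F x))"

definition grad :: "('a::real_inner \<Rightarrow> real) \<Rightarrow> 'a \<Rightarrow> 'a" where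
  "grad F x = (THE v. GDERIV F x :> v)"


section \<open>Subdifferentials and normal cones\<close>

definition delta :: "'a set \<Rightarrow> 'a \<Rightarrow> ereal" where
  "delta C x = (if x \<in> C then 0 else \<infinity>)"

definition eps_subdiff :: "real \<Rightarrow> ('a::real_inner \<Rightarrow> ereal) \<Rightarrow> 'a \<Rightarrow> 'a set" where
  "eps_subdiff \<epsilon> \<phi> x =
     {\<xi>. \<bar>\<phi> x\<bar> \<noteq> \<infinity> \<and> (\<forall>z. \<phi> z \<ge> \<phi> x + ereal (\<xi> \<bullet> (z - x) - \<epsilon>))}"

abbreviation subdiff :: "('a::real_inner \<Rightarrow> ereal) \<Rightarrow> 'a \<Rightarrow> 'a set" where
  "subdiff \<equiv> eps_subdiff 0"

definition normal_cone :: "'a::real_inner set \<Rightarrow> 'a \<Rightarrow> 'a set" where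
  "normal_cone C = subdiff (delta C)"

definition regular_subdiff :: "('a::real_inner \<Rightarrow> ereal) \<Rightarrow> 'a \<Rightarrow> 'a set" where
  "regular_subdiff \<phi> x =
     {v. \<bar>\<phi> x\<bar> \<noteq> \<infinity> \<and>
         (\<forall>e>0. \<forall>\<^sub>F z in at x. \<phi> z \<ge> \<phi> x + ereal (v \<bullet> (z - x) - e * norm (z - x)))}"

definition limiting_subdiff :: "('a::real_inner \<Rightarrow> ereal) \<Rightarrow> 'a \<Rightarrow> 'a set" where
  "limiting_subdiff \<phi> x =
     {v. \<bar>\<phi> x\<bar> \<noteq> \<infinity> \<and>
         (\<exists>xs vs. xs \<longlonglongrightarrow> x \<and> (\<lambda>n. \<phi> (xs n)) \<longlonglongrightarrow> \<phi> x \<and>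
                  (\<forall>n. vs n \<in> regular_subdiff \<phi> (xs n)) \<and> vs \<longlonglongrightarrow> v)}"

lemma regular_subdiff_convex:
  fixes p :: "'a::real_inner \<Rightarrow> real"
  assumes "convex_on UNIV p" and v: "v \<in> regular_subdiff (\<lambda>z. ereal (p z)) x"
  shows "p z \<ge> p x + v \<bullet> (z - x)"
proof (cases "z = x")
  case False
  let ?d = "z - x"
  have "v \<bullet> ?d \<le> p z - p x + e" if "e > 0" for e
  proof -
    define e' where "e' = e / norm ?d"
    have "e' > 0" using that False by (simp add: e'_def)
    then have "\<forall>\<^sub>F y in at x. p y \<ge> p x + v \<bullet> (y - x) - e' * norm (y - x)"
      using v by (auto simp: regular_subdiff_def algebra_simps)
    then obtain r where "r > 0"
      and r: "\<And>y. y \<noteq> x \<Longrightarrow> dist y x < r \<Longrightarrow> p y \<ge> p x + v \<bullet> (y - x) - e' * norm (y - x)"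
      by (auto simp: eventually_at)
    define s where "s = min 1 (r / (2 * norm ?d))"
    have s: "0 < s" "s \<le> 1" "s * norm ?d < r"
    proof -
      show "0 < s" "s \<le> 1" using \<open>r > 0\<close> False by (auto simp: s_def)
      have "s * norm ?d \<le> r / (2 * norm ?d) * norm ?d"
        by (intro mult_right_mono) (auto simp: s_def)
      also have "\<dots> = r / 2" using False by simp
      finally show "s * norm ?d < r" using \<open>r > 0\<close> by simp
    qed
    have "p (x + s *\<^sub>R ?d) \<ge> p x + s * (v \<bullet> ?d) - e' * (s * norm ?d)"
      using r[of "x + s *\<^sub>R ?d"] s False by (simp add: dist_norm)
    moreover have "p (x + s *\<^sub>R ?d) \<le> (1 - s) * p x + s * p z"
      using convex_onD[OF assms(1), of s x z] s by (simp add: algebra_simps)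
    ultimately have "s * (v \<bullet> ?d) \<le> s * (p z - p x + e' * norm ?d)"
      by (simp add: algebra_simps)
    then have "v \<bullet> ?d \<le> p z - p x + e' * norm ?d" using s by simp
    also have "e' * norm ?d = e" using False by (simp add: e'_def)
    finally show ?thesis by simp
  qed
  then have "v \<bullet> ?d \<le> p z - p x" by (rule field_le_epsilon)
  then show ?thesis by simp
qed simp

lemma limiting_subdiff_convex:
  fixes p :: "'a::real_inner \<Rightarrow> real"
  assumes "convex_on UNIV p"
  shows "limiting_subdiff (\<lambda>z. ereal (p z)) x = subdiff (\<lambda>z. ereal (p z)) x"
proof (intro subset_antisym subsetI)
  fix v assume "v \<in> limiting_subdiff (\<lambda>z. ereal (p z)) x"
  then obtain xs vs where *: "xs \<longlonglongrightarrow> x" "(\<lambda>n. p (xs n)) \<longlonglongrightarrow> p x" "vs \<longlonglongrightarrow> v"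
    "\<And>n. vs n \<in> regular_subdiff (\<lambda>z. ereal (p z)) (xs n)"
    by (auto simp: limiting_subdiff_def)
  have "p z \<ge> p x + v \<bullet> (z - x)" for z
  proof (rule LIMSEQ_le_const2)
    show "(\<lambda>n. p (xs n) + vs n \<bullet> (z - xs n)) \<longlonglongrightarrow> p x + v \<bullet> (z - x)"
      using * by (intro tendsto_intros)
    show "\<exists>N. \<forall>n\<ge>N. p (xs n) + vs n \<bullet> (z - xs n) \<le> p z"
      using regular_subdiff_convex[OF assms *(4)] by blast
  qed
  then show "v \<in> subdiff (\<lambda>z. ereal (p z)) x" by (simp add: eps_subdiff_def)
next
  fix v assume "v \<in> subdiff (\<lambda>z. ereal (p z)) x"
  then have *: "p z \<ge> p x + v \<bullet> (z - x)" for z by (simp add: eps_subdiff_def)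
  have "p z \<ge> p x + (v \<bullet> (z - x) - e * norm (z - x))" if "e > 0" for e z
  proof -
    have "e * norm (z - x) \<ge> 0" using that by simp
    with *[of z] show ?thesis by linarith
  qed
  then have "v \<in> regular_subdiff (\<lambda>z. ereal (p z)) x" by (simp add: regular_subdiff_def)
  then show "v \<in> limiting_subdiff (\<lambda>z. ereal (p z)) x"
    unfolding limiting_subdiff_def mem_Collect_eq
    by (intro conjI, simp) (rule exI[of _ "\<lambda>_. x"], rule exI[of _ "\<lambda>_. v"], simp)
qed

text \<open>
  Extended-real valued, so that the distance to the empty set is infinite
  (\<^const>\<open>infdist\<close> would give 0).
\<close>

definition dist_set :: "'a::metric_space \<Rightarrow> 'a set \<Rightarrow> ereal" where
  "dist_set y A = (INF a\<in>A. ereal (dist y a))"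


section \<open>The problem and its approximate KKT points\<close>

definition standing_assms ::
  "'a::euclidean_space set \<Rightarrow> ('a \<Rightarrow> real) \<Rightarrow> ('a \<Rightarrow> real) \<Rightarrow> ('a \<Rightarrow> real) \<Rightarrow>
   ('a \<Rightarrow> 'b::euclidean_space) \<Rightarrow> ('b \<Rightarrow> real) \<Rightarrow> real \<Rightarrow> real \<Rightarrow> real \<Rightarrow> real \<Rightarrow> bool" where
  "standing_assms C f P1 P2 c h Lf Lc Mc Mh \<longleftrightarrow>
     compact C \<and> convex C \<and> {x \<in> C. h (c x) \<le> 0} \<noteq> {} \<and>
     cont_diff f \<and> Lf > 0 \<and> Lf-lipschitz_on C (grad f) \<and>
     cont_diff c \<and> Lc \<ge> 0 \<and> Lc-lipschitz_on C (Df c) \<and>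
     Mc > 0 \<and> Mc-lipschitz_on C c \<and>
     convex_on UNIV P1 \<and> convex_on UNIV P2 \<and>
     convex_on UNIV h \<and> Mh > 0 \<and> Mh-lipschitz_on UNIV h"

definition objective ::
  "'a set \<Rightarrow> ('a \<Rightarrow> real) \<Rightarrow> ('a \<Rightarrow> real) \<Rightarrow> ('a \<Rightarrow> real) \<Rightarrow> 'a \<Rightarrow> ereal" where
  "objective C f P1 P2 x = ereal (f x + P1 x - P2 x) + delta C x"

definition KKT_point ::
  "'a::euclidean_space set \<Rightarrow> ('a \<Rightarrow> real) \<Rightarrow> ('a \<Rightarrow> real) \<Rightarrow> ('a \<Rightarrow> real) \<Rightarrow>
   ('a \<Rightarrow> 'b::euclidean_space) \<Rightarrow> ('b \<Rightarrow> real) \<Rightarrow> real \<Rightarrow> real \<Rightarrow> 'a \<Rightarrow> bool" where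
  "KKT_point C f P1 P2 c h \<epsilon>1 \<epsilon>2 x \<longleftrightarrow>
     x \<in> C \<and>
     (\<exists>z\<in>C. \<exists>u. \<exists>lam\<ge>0.
        dist_set 0 {grad f x + p1 - p2 + lam *\<^sub>R Df_adj c x u + n | p1 p2 n.
           p1 \<in> subdiff (\<lambda>y. ereal (P1 y)) x \<and> p2 \<in> subdiff (\<lambda>y. ereal (P2 y)) z \<and>
           n \<in> normal_cone C x} \<le> ereal \<epsilon>1 \<and>
        h (c x) \<le> \<epsilon>2 \<and>
        u \<in> eps_subdiff \<epsilon>2 (\<lambda>y. ereal (h y)) (c x) \<and>
        \<bar>lam * h (c x)\<bar> \<le> \<epsilon>2 \<and>
        norm (x - z) \<le> \<epsilon>1 * \<epsilon>2)"


section \<open>Smoothing approximations\<close>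

definition smoothing_approx ::
  "('b::euclidean_space \<Rightarrow> real) \<Rightarrow> (real \<Rightarrow> 'b \<Rightarrow> real) \<Rightarrow> real \<Rightarrow> real \<Rightarrow> real \<Rightarrow> real \<Rightarrow> bool" where
  "smoothing_approx \<phi> \<phi>s \<alpha>1 \<alpha>2 \<alpha>31 \<alpha>32 \<longleftrightarrow>
     convex_on UNIV \<phi> \<and> \<alpha>1 \<ge> 0 \<and> \<alpha>2 > 0 \<and> \<alpha>31 + \<alpha>32 > 0 \<and>
     (\<forall>\<mu>>0. convex_on UNIV (\<phi>s \<mu>) \<and> cont_diff (\<phi>s \<mu>) \<and>
        (\<alpha>1 + \<alpha>2 / \<mu>)-lipschitz_on UNIV (grad (\<phi>s \<mu>)) \<and>
        (\<forall>y. \<phi> y - \<alpha>31 * \<mu> \<le> \<phi>s \<mu> y \<and> \<phi>s \<mu> y \<le> \<phi> y + \<alpha>32 * \<mu>))"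

definition smoothing_monotone :: "(real \<Rightarrow> 'b \<Rightarrow> real) \<Rightarrow> real \<Rightarrow> bool" where
  "smoothing_monotone \<phi>s \<alpha>4 \<longleftrightarrow>
     \<alpha>4 \<ge> 0 \<and> (\<forall>\<mu>0 \<mu>1 y. \<mu>0 \<ge> \<mu>1 \<and> \<mu>1 > 0 \<longrightarrow> \<phi>s \<mu>1 y \<le> \<phi>s \<mu>0 y + \<alpha>4 * (\<mu>0 - \<mu>1))"

definition pos_part :: "real \<Rightarrow> real" where
  "pos_part s = max s 0"


section \<open>The algorithm\<close>

text \<open>
  In the next two definitions \<open>G\<close> stands for the smoothed constraint function at the current
  \<open>\<mu>\<close>, \<open>xk\<close> for the current iterate and \<open>Lt\<close> for the trial value of the
  backtracking parameter.
\<close>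

definition is_trial_point ::
  "'a::euclidean_space set \<Rightarrow> ('a \<Rightarrow> real) \<Rightarrow> ('a \<Rightarrow> real) \<Rightarrow> ('a \<Rightarrow> real) \<Rightarrow>
   real \<Rightarrow> real \<Rightarrow> 'a \<Rightarrow> 'a \<Rightarrow> real \<Rightarrow> 'a \<Rightarrow> bool" where
  "is_trial_point C f P1 G \<gamma> \<mu> xk \<xi> Lt =
     is_arg_min
       (\<lambda>x. ereal (\<gamma> * ((grad f xk - \<xi>) \<bullet> x + P1 x)
                    + (G xk + grad G xk \<bullet> (x - xk))
                    + Lt / (2 * \<mu>) * (norm (x - xk))\<^sup>2) + delta C x)
       (\<lambda>_. True)"

definition sufficient_decrease ::
  "('a::euclidean_space \<Rightarrow> ereal) \<Rightarrow> ('a \<Rightarrow> real) \<Rightarrow> real \<Rightarrow> real \<Rightarrow> real \<Rightarrow> 'a \<Rightarrow> 'a \<Rightarrow> bool" where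
  "sufficient_decrease \<psi> G c1 \<gamma> \<mu> xk xt \<longleftrightarrow>
     ereal \<gamma> * \<psi> xt + ereal (G xt)
       \<le> ereal \<gamma> * \<psi> xk + ereal (G xk) - ereal (c1 / (2 * \<mu>) * (norm (xt - xk))\<^sup>2)"

text \<open>
  A complete infinite run. The arguments before \<open>x\<close> are the data and inputs
  (\<open>gh\<close> is the input sequence of penalty weights, \<open>\<alpha>3\<phi>\<close> the constant
  \<open>\<alpha>\<^sub>3\<close> of the smoothing \<open>\<phi>s\<close> of the positive part); the others are the
  sequences produced, with \<open>L0 k\<close> the initial and \<open>L k\<close> the accepted
  backtracking parameter. The number \<open>i\<close> counts the doublings in iteration \<open>k\<close>.
\<close>

definition sESQM_run ::
  "'a::euclidean_space set \<Rightarrow> ('a \<Rightarrow> real) \<Rightarrow> ('a \<Rightarrow> real) \<Rightarrow> ('a \<Rightarrow> real) \<Rightarrow>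
   ('a \<Rightarrow> 'b::euclidean_space) \<Rightarrow> (real \<Rightarrow> 'b \<Rightarrow> real) \<Rightarrow> (real \<Rightarrow> real \<Rightarrow> real) \<Rightarrow> real \<Rightarrow>
   real \<Rightarrow> real \<Rightarrow> real \<Rightarrow> real \<Rightarrow> (nat \<Rightarrow> real) \<Rightarrow>
   (nat \<Rightarrow> 'a) \<Rightarrow> (nat \<Rightarrow> 'a) \<Rightarrow> (nat \<Rightarrow> real) \<Rightarrow> (nat \<Rightarrow> real) \<Rightarrow>
   (nat \<Rightarrow> nat) \<Rightarrow> (nat \<Rightarrow> real) \<Rightarrow> bool" where
  "sESQM_run C f P1 P2 c hs \<phi>s \<alpha>3\<phi> Llow Lup c1 c2 gh x \<xi> L0 L t \<mu> \<longleftrightarrow>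
     x 0 \<in> C \<and> \<mu> 0 > 0 \<and> Lup \<ge> Llow \<and> Llow > 0 \<and> c1 > 0 \<and> c2 > 0 \<and>
     (\<forall>k. gh k > 0) \<and> strict_antimono_on UNIV gh \<and>
     t 0 = 0 \<and>
     (\<forall>k. let \<gamma> = gh (t k);
              G = (\<lambda>y. \<phi>s (\<mu> k) (hs (\<mu> k) (c y)));
              trial = is_trial_point C f P1 G \<gamma> (\<mu> k) (x k) (\<xi> k);
              accept = sufficient_decrease (objective C f P1 P2) G c1 \<gamma> (\<mu> k) (x k)
          in
            \<xi> k \<in> subdiff (\<lambda>y. ereal (P2 y)) (x k) \<and> L0 k \<in> {Llow..Lup} \<and>
            (\<exists>i. L k = 2 ^ i * L0 k \<and> trial (L k) (x (Suc k)) \<and> accept (x (Suc k)) \<and>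
                 (\<forall>j<i. \<exists>y. trial (2 ^ j * L0 k) y \<and> \<not> accept y)) \<and>
            t (Suc k) =
              (if hs (\<mu> k) (c (x (Suc k))) > 2 * \<alpha>3\<phi> * \<mu> k
                  \<and> norm (x (Suc k) - x k) \<le> c2 * \<mu> k * \<gamma>
               then t k + 1 else t k) \<and>
            \<mu> (Suc k) \<in> {0<..\<mu> k})"

end

theory Submission
  imports Defs
begin

text \<open>
  Write \<open>d\<^sub>k = \<parallel>x\<^sup>k\<^sup>+\<^sup>1 - x\<^sup>k\<parallel>\<close>, \<open>\<gamma>\<^sub>k\<close> for the current penalty weight and \<open>g\<^sub>\<mu> = \<phi>\<^sub>\<mu> \<circ> h\<^sub>\<mu> \<circ> c\<close> for
  the smoothed constraint. Three facts carry the theorem.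

  \<^emph>\<open>Decrease.\<close> The function \<open>g\<^sub>\<mu>\<close> obeys a descent inequality on \<open>C\<close> whose constant \<open>L\<^sub>\<mu>\<close> grows only
  like \<open>1/\<mu>\<close> (\<open>gs_descent\<close>), so trial points are accepted as soon as the backtracking parameter
  is of order one, and the accepted parameters stay below \<open>M_L\<close> (\<open>L_le\<close>). The potential
  \<open>\<gamma>\<^sub>k (\<psi>(x\<^sup>k) - b) + g\<^sub>\<mu>(x\<^sup>k) + \<alpha>\<^sub>4 \<mu>\<^sub>k\<close> is bounded below and falls by at least \<open>c1 d\<^sub>k\<^sup>2 / (2 \<mu>\<^sub>k)\<close>
  in each iteration, hence \<open>\<Sum> \<mu>\<^sub>k (d\<^sub>k / \<mu>\<^sub>k)\<^sup>2\<close> is bounded (\<open>weighted_steps_summable\<close>).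

  \<^emph>\<open>Few updates.\<close> If the weight is lowered after iteration \<open>k\<close>, the new iterate is so infeasible
  that the slope of \<open>\<phi>\<^sub>\<mu>\<close> there exceeds \<open>1/2\<close>, while the step is short. The optimality condition of
  the subproblem then shows that the weight times a constant dominates half the distance
  between \<open>0\<close> and \<open>Dc(x)\<^sup>* u + N\<^sub>C(x)\<close>, where \<open>u\<close> is an approximate subgradient of \<open>h\<close>. By the
  constraint qualification that distance is at least \<open>\<eta>1\<close> (\<open>penalty_update_bound\<close>). So no
  weight falls below \<open>\<eta>\<gamma>\<close>, and there are at most \<open>M_t\<close> updates.

  \<^emph>\<open>Counting.\<close> Suppose every iteration in the window that does not update the weight has a large
  ratio \<open>d\<^sub>k / \<mu>\<^sub>k\<close>. The window is \<open>M_t\<close> longer than the range of the sum \<open>S K\<close>, so enough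
  iterations remain after discarding the updates, and as \<open>\<mu>\<close> is nonincreasing their \<open>\<mu>\<close>-mass is at
  least \<open>S K\<close>. That contradicts the bound on the weighted squares
  (\<open>exists_short_nonupdating_step\<close>). Hence some iteration has a short step and no update, which
  means an almost feasible new iterate; dividing its optimality condition by the weight gives the
  KKT conditions with multiplier \<open>\<phi>\<^sub>\<mu>' / \<gamma>\<^sub>k\<close> and \<open>z = x\<^sup>k\<close> (\<open>short_step_KKT\<close>).

  One point needs care: \<open>c\<close> is Lipschitz only on \<open>C\<close>, and when \<open>C\<close> has empty interior this says
  nothing about \<open>Dc\<close> in directions normal to \<open>C\<close>. The gradient of \<open>g\<^sub>\<mu>\<close> is therefore Lipschitz only
  up to vectors orthogonal to the affine hull of \<open>C\<close> (\<open>grad_gs_tangential_lipschitz\<close>); such vectors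
  are absorbed by the normal cone.
\<close>

section \<open>Gradients and descent inequalities\<close>

lemma GDERIV_grad:
  fixes F :: "'a::euclidean_space \<Rightarrow> real"
  assumes "F differentiable (at x)"
  shows "GDERIV F x :> grad F x"
proof -
  obtain F' where F': "(F has_derivative F') (at x)"
    using assms by (auto simp: differentiable_def)
  then have "linear F'"
    by (simp add: has_derivative_linear)
  then have "F' = (\<lambda>v. v \<bullet> adjoint F' 1)"
    using adjoint_works[of F' _ 1] by (simp add: fun_eq_iff)
  with F' have ex: "GDERIV F x :> adjoint F' 1"
    by (simp add: gderiv_def)
  moreover have "w = adjoint F' 1" if "GDERIV F x :> w" for w
  proof -
    have "(\<lambda>v. v \<bullet> w) = (\<lambda>v. v \<bullet> adjoint F' 1)"
      using that ex has_derivative_unique unfolding gderiv_def by blast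
    then show ?thesis
      by (simp add: fun_eq_iff vector_eq_ldot)
  qed
  ultimately show ?thesis
    unfolding grad_def by (rule theI)
qed

lemma grad_eqI:
  fixes F :: "'a::euclidean_space \<Rightarrow> real"
  assumes "GDERIV F x :> w"
  shows "grad F x = w"
proof -
  have "F differentiable (at x)"
    using assms by (auto simp: gderiv_def differentiable_def)
  then have "(\<lambda>v. v \<bullet> grad F x) = (\<lambda>v. v \<bullet> w)"
    using GDERIV_grad assms has_derivative_unique unfolding gderiv_def by blast
  then show ?thesis
    by (simp add: fun_eq_iff vector_eq_ldot)
qed

lemma has_derivative_Df:
  assumes "F differentiable (at x)"
  shows "(F has_derivative blinfun_apply (Df F x)) (at x)"
proof -
  have "(F has_derivative frechet_derivative F (at x)) (at x)"
    using assms frechet_derivative_works by blast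
  moreover from this have "blinfun_apply (Df F x) = frechet_derivative F (at x)"
    unfolding Df_def by (simp add: bounded_linear_Blinfun_apply has_derivative_bounded_linear)
  ultimately show ?thesis by simp
qed

lemma inner_Df_adj:
  fixes F :: "'a::euclidean_space \<Rightarrow> 'b::euclidean_space"
  shows "v \<bullet> Df_adj F x w = Df F x v \<bullet> w"
  unfolding Df_adj_def
  by (intro adjoint_works bounded_linear.linear blinfun.bounded_linear_right)

lemma Df_adj_scaleR:
  fixes F :: "'a::euclidean_space \<Rightarrow> 'b::euclidean_space"
  shows "Df_adj F x (r *\<^sub>R w) = r *\<^sub>R Df_adj F x w"
  by (rule euclidean_eqI) (simp add: inner_commute[of "Df_adj _ _ _"] inner_Df_adj)

text \<open>
  The growth bound is asked for only along \<open>y - x\<close>, and only from the base point \<open>x\<close>: subtract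
  the tangent and the parabola from \<open>F\<close> on the segment, and the derivative of what is left is
  nonpositive. In this form it also applies to \<open>w \<bullet> c\<close>, whose derivative is controlled on \<open>C\<close> only.
\<close>

lemma descent_inequality:
  fixes F :: "'a::real_normed_vector \<Rightarrow> real"
  assumes "convex C" "x \<in> C" "y \<in> C"
    and der: "\<And>z. z \<in> C \<Longrightarrow> (F has_derivative F' z) (at z)"
    and growth: "\<And>z. z \<in> C \<Longrightarrow> F' z (y - x) - F' x (y - x) \<le> l * norm (z - x) * norm (y - x)"
  shows "F y \<le> F x + F' x (y - x) + l / 2 * (norm (y - x))\<^sup>2"
proof -
  define d where "d = y - x"
  define g where "g s = F (x + s *\<^sub>R d) - s * F' x d - l / 2 * s\<^sup>2 * (norm d)\<^sup>2" for s
  have inC: "x + s *\<^sub>R d \<in> C" if "0 \<le> s" "s \<le> 1" for s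
    using convexD_alt[OF assms(1-3) that] by (simp add: d_def algebra_simps)
  have "g 1 \<le> g 0"
  proof (rule DERIV_nonpos_imp_nonincreasing[of 0 1 g])
    fix s :: real
    assume s: "0 \<le> s" "s \<le> 1"
    let ?z = "x + s *\<^sub>R d"
    have lin: "F' ?z (r *\<^sub>R d) = r * F' ?z d" for r
      using has_derivative_linear[OF der[OF inC[OF s]]] by (simp add: linear_cmul)
    have "((\<lambda>s. F (x + s *\<^sub>R d)) has_derivative (\<lambda>r. F' ?z (r *\<^sub>R d))) (at s)"
      by (rule has_derivative_compose[where g = F and f = "\<lambda>s. x + s *\<^sub>R d", OF _ der[OF inC[OF s]]])
        (auto intro!: derivative_eq_intros)
    then have "((\<lambda>s. F (x + s *\<^sub>R d)) has_real_derivative F' ?z d) (at s)"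
      by (simp add: lin has_field_derivative_def mult_commute_abs)
    then have "(g has_real_derivative F' ?z d - F' x d - l * s * (norm d)\<^sup>2) (at s)"
      unfolding g_def by (auto intro!: derivative_eq_intros)
    moreover have "F' ?z d - F' x d - l * s * (norm d)\<^sup>2 \<le> 0"
      using growth[OF inC[OF s]] s by (simp add: d_def power2_eq_square mult.assoc)
    ultimately show "\<exists>D. (g has_real_derivative D) (at s) \<and> D \<le> 0" by blast
  qed simp
  then show ?thesis by (simp add: g_def d_def)
qed

lemma gradient_descent_inequality:
  fixes F :: "'a::euclidean_space \<Rightarrow> real"
  assumes "convex C" "x \<in> C" "y \<in> C" "\<And>z. z \<in> C \<Longrightarrow> F differentiable (at z)"
    and lip: "l-lipschitz_on C (grad F)"
  shows "F y \<le> F x + grad F x \<bullet> (y - x) + l / 2 * (norm (y - x))\<^sup>2"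
proof -
  have "(y - x) \<bullet> grad F z - (y - x) \<bullet> grad F x \<le> l * norm (z - x) * norm (y - x)" if "z \<in> C" for z
  proof -
    have "(y - x) \<bullet> (grad F z - grad F x) \<le> norm (y - x) * norm (grad F z - grad F x)"
      by (rule norm_cauchy_schwarz)
    also have "\<dots> \<le> norm (y - x) * (l * norm (z - x))"
      using lipschitz_onD[OF lip that \<open>x \<in> C\<close>] by (intro mult_left_mono) (auto simp: dist_norm)
    finally show ?thesis by (simp add: inner_diff_right mult_ac)
  qed
  from descent_inequality[where F' = "\<lambda>z v. v \<bullet> grad F z", OF assms(1-3) _ this]
  show ?thesis
    using GDERIV_grad assms(4) by (auto simp: gderiv_def inner_commute)
qed

text \<open>
  A function that is Lipschitz on \<open>C\<close> has a derivative bounded by the same constant, but only on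
  directions parallel to the affine hull. From a relative interior point one can move a little
  in each such direction without leaving \<open>C\<close>; the remaining points are limits of relative
  interior points, and the derivative is continuous.
\<close>

lemma tangential_derivative_bound:
  fixes F :: "'a::euclidean_space \<Rightarrow> 'b::euclidean_space"
  assumes "convex C" and lip: "l-lipschitz_on C F"
    and diff: "\<And>z. F differentiable (at z)" and cont: "continuous_on UNIV (Df F)"
    and "x \<in> C" "a \<in> C" and v: "v \<in> span ((\<lambda>z. z - a) ` C)"
  shows "norm (Df F x v) \<le> l * norm v"
proof -
  have rel: "norm (Df F z v) \<le> l * norm v" if z: "z \<in> rel_interior C" for z
  proof (cases "v = 0")
    case False
    obtain r where "z \<in> C" "r > 0" and r: "ball z r \<inter> affine hull C \<subseteq> C"
      using z by (auto simp: mem_rel_interior_ball)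
    have aff: "affine hull C = (\<lambda>w. a + w) ` span ((\<lambda>z. z - a) ` C)"
      using affine_hull_span_gen[OF hull_inc[OF \<open>a \<in> C\<close>]] by (simp only: uminus_add_conv_diff)
    then obtain w where w: "z = a + w" "w \<in> span ((\<lambda>z. z - a) ` C)"
      using hull_inc[OF \<open>z \<in> C\<close>, of affine] unfolding aff by blast
    have "norm (Df F z v) \<le> l * norm v + e * norm v" if "e > 0" for e
    proof -
      obtain d where "d > 0"
        and d: "\<And>y. norm (y - z) < d \<Longrightarrow> norm (F y - F z - Df F z (y - z)) \<le> e * norm (y - z)"
        using has_derivative_Df[OF diff[of z]] \<open>e > 0\<close> unfolding has_derivative_at_alt by blast
      define s where "s = min d r / (2 * norm v)"
      have s: "s > 0" "s * norm v < d" "s * norm v < r"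
        using \<open>d > 0\<close> \<open>r > 0\<close> False by (auto simp: s_def)
      let ?y = "z + s *\<^sub>R v"
      have "?y \<in> affine hull C"
        unfolding aff w(1) using w(2) v by (auto intro!: image_eqI[where x = "w + s *\<^sub>R v"] span_add span_scale)
      moreover have "?y \<in> ball z r" using s by (simp add: dist_norm)
      ultimately have "?y \<in> C" using r by blast
      then have "norm (F ?y - F z) \<le> l * (s * norm v)"
        using lipschitz_onD[OF lip _ \<open>z \<in> C\<close>, of ?y] s by (simp add: dist_norm)
      moreover have "norm (F ?y - F z - s *\<^sub>R Df F z v) \<le> e * (s * norm v)"
        using d[of ?y] s by (simp add: blinfun.scaleR_right)
      ultimately have "norm (s *\<^sub>R Df F z v) \<le> l * (s * norm v) + e * (s * norm v)"
        using norm_triangle_ineq4[of "F ?y - F z" "F ?y - F z - s *\<^sub>R Df F z v"] by simp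
      then have "s * norm (Df F z v) \<le> s * (l * norm v + e * norm v)"
        using s by (simp add: algebra_simps)
      then show ?thesis using s by simp
    qed
    note eps = this
    show ?thesis
    proof (rule field_le_epsilon)
      fix e :: real assume "e > 0"
      then show "norm (Df F z v) \<le> l * norm v + e"
        using eps[of "e / norm v"] False by simp
    qed
  qed (simp add: blinfun.zero_right)
  have "x \<in> closure (rel_interior C)"
    using \<open>x \<in> C\<close> closure_subset convex_closure_rel_interior[OF \<open>convex C\<close>] by blast
  then obtain X where X: "\<And>n. X n \<in> rel_interior C" "X \<longlonglongrightarrow> x"
    by (auto simp: closure_sequential)
  have "(\<lambda>n. Df F (X n)) \<longlonglongrightarrow> Df F x"
    using continuous_on_tendsto_compose[OF cont X(2)] by simp
  then have "(\<lambda>n. norm (Df F (X n) v)) \<longlonglongrightarrow> norm (Df F x v)"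
    by (intro tendsto_intros)
  then show ?thesis
    by (rule LIMSEQ_le_const2) (use rel X in blast)
qed

section \<open>Convex functions and normal cones\<close>

lemma gradient_inequality:
  fixes F :: "'a::euclidean_space \<Rightarrow> real"
  assumes "convex_on UNIV F" "F differentiable (at x)"
  shows "F z \<ge> F x + grad F x \<bullet> (z - x)"
proof (rule regular_subdiff_convex[OF assms(1)])
  have der: "(F has_derivative (\<lambda>v. v \<bullet> grad F x)) (at x)"
    using GDERIV_grad[OF assms(2)] by (simp add: gderiv_def)
  have "\<forall>\<^sub>F z in at x. F z \<ge> F x + (grad F x \<bullet> (z - x) - e * norm (z - x))" if "e > 0" for e
  proof -
    obtain d where "d > 0"
      and d: "\<And>y. norm (y - x) < d \<Longrightarrow> norm (F y - F x - (y - x) \<bullet> grad F x) \<le> e * norm (y - x)"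
      using der \<open>e > 0\<close> unfolding has_derivative_at_alt by blast
    have "F z \<ge> F x + (grad F x \<bullet> (z - x) - e * norm (z - x))" if "dist z x < d" for z
      using d[of z] that by (simp add: dist_norm inner_commute abs_le_iff)
    with \<open>d > 0\<close> show ?thesis
      by (auto simp: eventually_at)
  qed
  then show "grad F x \<in> regular_subdiff (\<lambda>z. ereal (F z)) x"
    by (simp add: regular_subdiff_def)
qed

lemma mem_normal_cone_iff:
  assumes "x \<in> C"
  shows "n \<in> normal_cone C x \<longleftrightarrow> (\<forall>z\<in>C. n \<bullet> (z - x) \<le> 0)"
  using assms by (auto simp: normal_cone_def eps_subdiff_def delta_def)

lemma normal_cone_scaleR:
  assumes "x \<in> C" "n \<in> normal_cone C x" "r \<ge> 0"
  shows "r *\<^sub>R n \<in> normal_cone C x"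
  using assms by (simp add: mem_normal_cone_iff mult_nonneg_nonpos)

lemma mem_eps_subdiff_real_iff:
  "\<xi> \<in> eps_subdiff e (\<lambda>y. ereal (p y)) x \<longleftrightarrow> (\<forall>z. p z \<ge> p x + \<xi> \<bullet> (z - x) - e)"
  by (auto simp: eps_subdiff_def algebra_simps)

text \<open>
  Used to bound gradients of smoothings: a convex function that stays within a constant of an
  \<open>m\<close>-Lipschitz one cannot have a gradient longer than \<open>m\<close>. The contradiction comes from a large
  multiple of \<open>d\<close> itself.
\<close>

lemma norm_le_of_linear_growth:
  fixes d :: "'a::real_inner"
  assumes "\<And>z. d \<bullet> z \<le> A + m * norm z" "m \<ge> 0"
  shows "norm d \<le> m"
proof (rule ccontr)
  assume "\<not> norm d \<le> m"
  then have pos: "norm d > m" "norm d > 0" using assms(2) by auto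
  define r where "r = (\<bar>A\<bar> + 1) / (norm d * (norm d - m))"
  have "d \<bullet> (r *\<^sub>R d) \<le> A + m * norm (r *\<^sub>R d)" by (rule assms)
  moreover have "r > 0" using pos by (simp add: r_def)
  ultimately have "r * (norm d * norm d) \<le> A + m * (r * norm d)"
    by (simp flip: power2_eq_square add: power2_norm_eq_inner)
  then have "r * (norm d * (norm d - m)) \<le> A" by (simp add: algebra_simps)
  moreover have "r * (norm d * (norm d - m)) = \<bar>A\<bar> + 1" using pos by (simp add: r_def)
  ultimately show False by linarith
qed

text \<open>
  A subgradient \<open>v\<close> at \<open>y\<close> forces \<open>p\<close> to grow by \<open>norm v\<close> between \<open>y\<close> and the point at distance one in
  direction \<open>v\<close>, whereas \<open>p\<close> is bounded on the compact set of all points within distance one of \<open>C\<close>.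
\<close>

lemma subdiff_bounded_on_compact:
  fixes p :: "'a::euclidean_space \<Rightarrow> real"
  assumes "convex_on UNIV p" "compact C"
  shows "bdd_above {norm v | v y. y \<in> C \<and> v \<in> subdiff (\<lambda>z. ereal (p z)) y}"
proof -
  have cont: "continuous_on S p" for S
    using convex_on_continuous[OF open_UNIV assms(1)] continuous_on_subset by blast
  define S where "S = (\<lambda>(y, w). y + w) ` (C \<times> cball 0 1)"
  have "compact S"
    unfolding S_def by (intro compact_continuous_image compact_Times assms compact_cball)
      (auto intro!: continuous_intros simp: case_prod_unfold)
  then obtain B where B: "\<And>y. y \<in> S \<Longrightarrow> \<bar>p y\<bar> \<le> B"
    using compact_imp_bounded[OF compact_continuous_image[OF cont]] by (fastforce simp: bounded_iff)
  have "norm v \<le> 2 * B" if "y \<in> C" "v \<in> subdiff (\<lambda>z. ereal (p z)) y" for v y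
  proof -
    have "p (y + sgn v) \<ge> p y + v \<bullet> sgn v"
      using that(2) by (simp add: mem_eps_subdiff_real_iff) (metis add_diff_cancel_left')
    moreover have "v \<bullet> sgn v = norm v"
      by (cases "v = 0") (simp_all add: sgn_div_norm dot_square_norm power2_eq_square)
    moreover have "(y, sgn v) \<in> C \<times> cball 0 1" "(y, 0) \<in> C \<times> cball 0 1"
      using that by (auto simp: norm_sgn)
    then have "y + sgn v \<in> S" "y \<in> S"
      unfolding S_def by (auto intro: image_eqI[where x = "(y, sgn v)"] image_eqI[where x = "(y, 0)"])
    ultimately show ?thesis using B[of "y + sgn v"] B[of y] by linarith
  qed
  then show ?thesis by (auto intro!: bdd_aboveI[of _ "2 * B"])
qed

text \<open>
  Fermat's rule together with the sum rule for \<open>p + q \<bullet> _\<close> and the indicator of \<open>C\<close>. The strict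
  epigraph of \<open>p\<close> plus the linear term, shifted to vanish at \<open>x\<close>, is disjoint from \<open>C \<times> {..0}\<close>;
  a separating hyperplane in the product space cannot be vertical because the epigraph projects
  onto the whole space, and its slope is the normal vector.
\<close>

lemma constrained_minimum_subgradient:
  fixes p :: "'a::euclidean_space \<Rightarrow> real"
  assumes p: "convex_on UNIV p" and C: "convex C" "x \<in> C"
    and min: "\<And>y. y \<in> C \<Longrightarrow> p y + q \<bullet> (y - x) \<ge> p x"
  obtains v n where "v \<in> subdiff (\<lambda>z. ereal (p z)) x" "n \<in> normal_cone C x" "q + v + n = 0"
proof -
  define A where "A = {(y, r). p y - p x + q \<bullet> (y - x) < r}"
  define B where "B = C \<times> {..0::real}"
  have "convex A"
  proof (rule convexI)
    fix z w and u v :: real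
    assume "z \<in> A" "w \<in> A" and uv: "0 \<le> u" "0 \<le> v" "u + v = 1"
    then obtain y r y' r' where zw: "z = (y, r)" "w = (y', r')"
      and lt: "p y - p x + q \<bullet> (y - x) < r" "p y' - p x + q \<bullet> (y' - x) < r'"
      by (auto simp: A_def)
    have le: "p (u *\<^sub>R y + v *\<^sub>R y') \<le> u * p y + v * p y'"
      using p uv by (simp add: convex_on_def)
    have "u * (p y - p x + q \<bullet> (y - x)) + v * (p y' - p x + q \<bullet> (y' - x)) < u * r + v * r'"
    proof (cases "u = 0")
      case True then show ?thesis using uv lt by simp
    next
      case False
      then show ?thesis using uv lt
        by (intro add_less_le_mono mult_strict_left_mono mult_left_mono) auto
    qed
    moreover have "u * (p y - p x + q \<bullet> (y - x)) + v * (p y' - p x + q \<bullet> (y' - x)) =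
        u * p y + v * p y' - (u + v) * p x + q \<bullet> (u *\<^sub>R y + v *\<^sub>R y') - (u + v) * (q \<bullet> x)"
      by (simp add: algebra_simps inner_simps)
    ultimately show "u *\<^sub>R z + v *\<^sub>R w \<in> A"
      using le uv(3) by (simp add: A_def zw inner_simps)
  qed
  moreover have "convex B" unfolding B_def by (intro convex_Times C convex_real_interval)
  moreover have "(x, 1) \<in> A" "(x, 0) \<in> B" using C by (auto simp: A_def B_def)
  moreover have "B \<inter> A = {}" using min by (force simp: A_def B_def)
  ultimately obtain ab b0 where "ab \<noteq> 0" and sepB: "\<And>z. z \<in> B \<Longrightarrow> ab \<bullet> z \<le> b0"
    and sepA: "\<And>z. z \<in> A \<Longrightarrow> ab \<bullet> z \<ge> b0"
    using separating_hyperplane_sets[of B A] by blast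
  obtain a \<beta> where ab: "ab = (a, \<beta>)" by (cases ab)
  have ge: "a \<bullet> y + \<beta> * r \<ge> b0" if "p y - p x + q \<bullet> (y - x) < r" for y r
    using sepA[of "(y, r)"] that by (simp add: ab A_def)
  have le: "a \<bullet> y \<le> b0" if "y \<in> C" for y
    using sepB[of "(y, 0)"] that by (simp add: ab B_def)
  \<comment> \<open>The separation extends to the closure of the epigraph.\<close>
  have ge': "a \<bullet> y + \<beta> * (p y - p x + q \<bullet> (y - x)) \<ge> b0" for y
  proof (rule LIMSEQ_le_const[where X = "\<lambda>n. a \<bullet> y + \<beta> * (p y - p x + q \<bullet> (y - x) + inverse (real (Suc n)))"])
    show "(\<lambda>n. a \<bullet> y + \<beta> * (p y - p x + q \<bullet> (y - x) + inverse (real (Suc n))))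
        \<longlonglongrightarrow> a \<bullet> y + \<beta> * (p y - p x + q \<bullet> (y - x))"
      by (rule tendsto_eq_rhs, (rule tendsto_intros LIMSEQ_inverse_real_of_nat)+) simp
    show "\<exists>N. \<forall>n\<ge>N. b0 \<le> a \<bullet> y + \<beta> * (p y - p x + q \<bullet> (y - x) + inverse (real (Suc n)))"
      by (intro exI allI impI ge) simp
  qed
  have b0: "b0 = a \<bullet> x" using ge'[of x] le[of x] C by simp
  have "\<beta> \<ge> 0" using ge[of x 1] b0 by simp
  have "\<beta> \<noteq> 0"
  proof
    assume "\<beta> = 0"
    then have "a \<bullet> (x - a) \<ge> a \<bullet> x" using ge'[of "x - a"] b0 by simp
    then have "a \<bullet> a \<le> 0" by (simp add: inner_diff_right)
    then have "a = 0" using inner_ge_zero[of a] inner_eq_zero_iff[of a] by linarith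
    with \<open>\<beta> = 0\<close> \<open>ab \<noteq> 0\<close> show False by (simp add: ab zero_prod_def)
  qed
  with \<open>\<beta> \<ge> 0\<close> have "\<beta> > 0" by simp
  define n where "n = a /\<^sub>R \<beta>"
  have "n \<bullet> (z - x) \<le> 0" if "z \<in> C" for z
    using le[OF that] b0 \<open>\<beta> > 0\<close> by (simp add: n_def inner_diff_right mult_le_cancel_left_pos)
  then have "n \<in> normal_cone C x" using C by (simp add: mem_normal_cone_iff)
  moreover have "- q - n \<in> subdiff (\<lambda>z. ereal (p z)) x"
    unfolding mem_eps_subdiff_real_iff
  proof
    fix z
    have "0 \<le> (a \<bullet> (z - x) + \<beta> * (p z - p x + q \<bullet> (z - x))) / \<beta>"
      using ge'[of z] b0 \<open>\<beta> > 0\<close> by (simp add: inner_diff_right)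
    also have "\<dots> = n \<bullet> (z - x) + (p z - p x + q \<bullet> (z - x))"
      using \<open>\<beta> > 0\<close> by (simp add: n_def field_simps)
    finally show "p x + (- q - n) \<bullet> (z - x) - 0 \<le> p z" by (simp add: inner_diff_left)
  qed
  ultimately show ?thesis using that[of "- q - n" n] by simp
qed

section \<open>Smoothing approximations\<close>

lemma smoothing_grad_bound:
  assumes sm: "smoothing_approx \<phi> \<phi>s a1 a2 a31 a32" and "m > 0" and lip: "l-lipschitz_on UNIV \<phi>"
  shows "norm (grad (\<phi>s m) y) \<le> l"
proof (rule norm_le_of_linear_growth)
  fix z
  have "\<phi>s m (y + z) \<ge> \<phi>s m y + grad (\<phi>s m) y \<bullet> (y + z - y)"
    using sm \<open>m > 0\<close> by (intro gradient_inequality) (auto simp: smoothing_approx_def cont_diff_def)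
  moreover have "\<phi>s m (y + z) \<le> \<phi> (y + z) + a32 * m" "\<phi> y - a31 * m \<le> \<phi>s m y"
    using sm \<open>m > 0\<close> by (auto simp: smoothing_approx_def)
  moreover have "\<phi> (y + z) - \<phi> y \<le> l * norm z"
    using lipschitz_onD[OF lip, of "y + z" y] by (simp add: dist_norm abs_le_iff)
  ultimately show "grad (\<phi>s m) y \<bullet> z \<le> (a31 + a32) * m + l * norm z"
    by (simp add: algebra_simps)
qed (rule lipschitz_on_nonneg[OF lip])

text \<open>
  The tangent of the smoothing minorizes it, and passing from \<open>\<phi>s m\<close> to \<open>\<phi>\<close> costs \<open>a32 * m\<close> at \<open>z\<close>
  and \<open>a31 * m\<close> at \<open>y\<close>.
\<close>

lemma smoothing_grad_eps_subgradient:
  assumes sm: "smoothing_approx \<phi> \<phi>s a1 a2 a31 a32" and "m > 0" and "(a31 + a32) * m \<le> e"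
  shows "grad (\<phi>s m) y \<in> eps_subdiff e (\<lambda>y. ereal (\<phi> y)) y"
  unfolding mem_eps_subdiff_real_iff
proof
  fix z
  have "\<phi>s m z \<ge> \<phi>s m y + grad (\<phi>s m) y \<bullet> (z - y)"
    using sm \<open>m > 0\<close> by (intro gradient_inequality) (auto simp: smoothing_approx_def cont_diff_def)
  moreover have "\<phi>s m z \<le> \<phi> z + a32 * m" "\<phi> y - a31 * m \<le> \<phi>s m y"
    using sm \<open>m > 0\<close> by (auto simp: smoothing_approx_def)
  ultimately show "\<phi> y + grad (\<phi>s m) y \<bullet> (z - y) - e \<le> \<phi> z"
    using assms(3) by (simp add: algebra_simps)
qed

lemma pos_part_lipschitz: "1-lipschitz_on UNIV pos_part"
  by (auto simp: lipschitz_on_def pos_part_def dist_real_def max_def)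

text \<open>
  Nonnegativity holds because a negative slope at \<open>s\<close> would make the convex function \<open>\<phi>s m\<close>
  unbounded to the left, where it is within a constant of zero.
\<close>

lemma smoothed_pos_part_slope:
  assumes sm: "smoothing_approx pos_part \<phi>s a1 a2 a31 a32" and "m > 0"
  shows "0 \<le> grad (\<phi>s m) s" "grad (\<phi>s m) s \<le> 1"
proof -
  show "grad (\<phi>s m) s \<le> 1"
    using smoothing_grad_bound[OF sm \<open>m > 0\<close> pos_part_lipschitz, of s] by simp
  show "0 \<le> grad (\<phi>s m) s"
  proof (rule ccontr)
    assume neg: "\<not> 0 \<le> grad (\<phi>s m) s"
    define d where "d = - grad (\<phi>s m) s"
    have "d > 0" using neg by (simp add: d_def)
    define r where "r = \<bar>s\<bar> + (\<bar>(a31 + a32) * m\<bar> + 1) / d"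
    have "\<bar>(a31 + a32) * m\<bar> + 1 = d * ((\<bar>(a31 + a32) * m\<bar> + 1) / d)"
      using \<open>d > 0\<close> by simp
    also have "\<dots> \<le> d * r"
      using \<open>d > 0\<close> by (intro mult_left_mono) (auto simp: r_def)
    finally have dr: "d * r \<ge> \<bar>(a31 + a32) * m\<bar> + 1" .
    have "r \<ge> \<bar>s\<bar>" using \<open>d > 0\<close> by (simp add: r_def)
    then have "pos_part (s - r) = 0" by (simp add: pos_part_def)
    moreover have "\<phi>s m (s - r) \<ge> \<phi>s m s + grad (\<phi>s m) s \<bullet> (s - r - s)"
      using sm \<open>m > 0\<close> by (intro gradient_inequality) (auto simp: smoothing_approx_def cont_diff_def)
    moreover have "\<phi>s m (s - r) \<le> pos_part (s - r) + a32 * m" "pos_part s - a31 * m \<le> \<phi>s m s"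
      using sm \<open>m > 0\<close> by (auto simp: smoothing_approx_def)
    moreover have "pos_part s \<ge> 0" by (simp add: pos_part_def)
    ultimately have "d * r \<le> (a31 + a32) * m" by (simp add: d_def algebra_simps)
    with dr show False by linarith
  qed
qed

text \<open>
  The tangent at \<open>s\<close>, evaluated at the origin. It is the source of the next two lemmas: the slope
  is large where the constraint is violated, and slope times constraint value is small where it
  is nearly satisfied, which is approximate complementarity.
\<close>

lemma smoothed_pos_part_slope_inequality:
  assumes sm: "smoothing_approx pos_part \<phi>s a1 a2 a31 a32" and "m > 0"
  shows "pos_part s - (a31 + a32) * m \<le> grad (\<phi>s m) s * s"
proof -
  have "\<phi>s m 0 \<ge> \<phi>s m s + grad (\<phi>s m) s \<bullet> (0 - s)"
    using sm \<open>m > 0\<close> by (intro gradient_inequality) (auto simp: smoothing_approx_def cont_diff_def)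
  moreover have "\<phi>s m 0 \<le> pos_part 0 + a32 * m" "pos_part s - a31 * m \<le> \<phi>s m s"
    using sm \<open>m > 0\<close> by (auto simp: smoothing_approx_def)
  ultimately show ?thesis by (simp add: pos_part_def algebra_simps)
qed

lemma smoothed_pos_part_slope_gt_half:
  assumes sm: "smoothing_approx pos_part \<phi>s a1 a2 a31 a32" and "m > 0"
    and s: "s > 2 * (a31 + a32) * m"
  shows "grad (\<phi>s m) s > 1 / 2"
proof -
  have "(a31 + a32) * m > 0" using sm \<open>m > 0\<close> by (simp add: smoothing_approx_def)
  then have "s > 0" "s / 2 < s - (a31 + a32) * m" using s by (auto simp: algebra_simps)
  moreover from \<open>s > 0\<close> have "s - (a31 + a32) * m \<le> grad (\<phi>s m) s * s"
    using smoothed_pos_part_slope_inequality[OF sm \<open>m > 0\<close>, of s] by (simp add: pos_part_def)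
  ultimately have "(1 / 2) * s < grad (\<phi>s m) s * s" by linarith
  then show ?thesis using \<open>s > 0\<close> mult_less_cancel_right_pos by blast
qed

lemma smoothed_pos_part_slope_times_le:
  assumes sm: "smoothing_approx pos_part \<phi>s a1 a2 a31 a32" and "m > 0"
    and s: "s \<le> 2 * (a31 + a32) * m"
  shows "\<bar>grad (\<phi>s m) s * s\<bar> \<le> 2 * (a31 + a32) * m"
proof -
  have pos: "(a31 + a32) * m > 0" using sm \<open>m > 0\<close> by (simp add: smoothing_approx_def)
  note slope = smoothed_pos_part_slope[OF sm \<open>m > 0\<close>, of s]
  have "grad (\<phi>s m) s * s \<ge> - ((a31 + a32) * m)"
    using smoothed_pos_part_slope_inequality[OF sm \<open>m > 0\<close>, of s] by (simp add: pos_part_def)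
  moreover have "grad (\<phi>s m) s * s \<le> 2 * (a31 + a32) * m"
  proof (cases "s \<ge> 0")
    case True
    then have "grad (\<phi>s m) s * s \<le> s" using slope mult_right_mono[of _ 1 s] by simp
    with s show ?thesis by linarith
  next
    case False
    then have "grad (\<phi>s m) s * s \<le> 0" using slope by (simp add: mult_nonneg_nonpos)
    with pos show ?thesis by linarith
  qed
  ultimately show ?thesis using pos by (auto simp: abs_le_iff algebra_simps)
qed

lemma smoothed_pos_part_increment:
  assumes sm: "smoothing_approx pos_part \<phi>s a1 a2 a31 a32" and "m > 0" and "s \<le> r + d" "d \<ge> 0"
  shows "\<phi>s m s \<le> \<phi>s m r + d"
proof -
  have "\<phi>s m r \<ge> \<phi>s m s + grad (\<phi>s m) s \<bullet> (r - s)"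
    using sm \<open>m > 0\<close> by (intro gradient_inequality) (auto simp: smoothing_approx_def cont_diff_def)
  moreover have "grad (\<phi>s m) s * (s - r) \<le> d"
  proof (cases "s \<ge> r")
    case True
    then have "grad (\<phi>s m) s * (s - r) \<le> 1 * (s - r)"
      using smoothed_pos_part_slope[OF sm \<open>m > 0\<close>] by (intro mult_right_mono) auto
    then show ?thesis using assms(3) by simp
  next
    case False
    then have "grad (\<phi>s m) s * (s - r) \<le> 0"
      using smoothed_pos_part_slope[OF sm \<open>m > 0\<close>] by (simp add: mult_nonneg_nonpos)
    then show ?thesis using assms(4) by linarith
  qed
  ultimately show ?thesis by (simp add: algebra_simps)
qed

section \<open>Trial points\<close>

text \<open>
  Moving from \<open>xt\<close> towards \<open>y \<in> C\<close> by a fraction \<open>s\<close> changes the model by \<open>s\<close> times its linearization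
  plus a term of order \<open>s\<^sup>2\<close>, so \<open>xt\<close> also minimizes the model with the quadratic term replaced
  by its linearization, to which the sum rule applies.
\<close>

lemma trial_point_stationary:
  fixes f P1 :: "'a::euclidean_space \<Rightarrow> real"
  assumes trial: "is_trial_point C f P1 G \<gamma> m xk \<xi> Lt xt"
    and C: "convex C" "xk \<in> C" and P1: "convex_on UNIV P1" and pos: "\<gamma> > 0"
  obtains p n where "xt \<in> C" "p \<in> subdiff (\<lambda>z. ereal (P1 z)) xt" "n \<in> normal_cone C xt"
    "\<gamma> *\<^sub>R (grad f xk - \<xi> + p) + grad G xk + (Lt / m) *\<^sub>R (xt - xk) + n = 0"
proof -
  define a where "a = grad f xk - \<xi>"
  define b where "b = grad G xk"
  define q where "q = a + (b + (Lt / m) *\<^sub>R (xt - xk)) /\<^sub>R \<gamma>"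
  define J where "J y = \<gamma> * (a \<bullet> y + P1 y) + (G xk + b \<bullet> (y - xk)) + Lt / (2 * m) * (norm (y - xk))\<^sup>2" for y
  have min: "ereal (J xt) + delta C xt \<le> ereal (J y) + delta C y" for y
    using trial unfolding is_trial_point_def is_arg_min_linorder J_def a_def b_def by blast
  have "xt \<in> C" using min[of xk] C by (auto simp: delta_def split: if_splits)
  have minC: "J xt \<le> J y" if "y \<in> C" for y
    using min[of y] that \<open>xt \<in> C\<close> by (simp add: delta_def)
  have "P1 y + q \<bullet> (y - xt) \<ge> P1 xt" if "y \<in> C" for y
  proof -
    define d where "d = y - xt"
    define A where "A = \<gamma> * (a \<bullet> d + P1 y - P1 xt) + b \<bullet> d + (Lt / m) * ((xt - xk) \<bullet> d)"
    define B where "B = Lt / (2 * m) * (norm d)\<^sup>2"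
    have "0 \<le> A + s * B" if s: "0 < s" "s \<le> 1" for s
    proof -
      let ?z = "xt + s *\<^sub>R d"
      have z: "?z = (1 - s) *\<^sub>R xt + s *\<^sub>R y" by (simp add: d_def algebra_simps)
      then have "?z \<in> C" using convexD_alt[OF C(1) \<open>xt \<in> C\<close> \<open>y \<in> C\<close>] s by simp
      then have "J xt \<le> J ?z" by (rule minC)
      moreover have "P1 ?z \<le> P1 xt + s * (P1 y - P1 xt)"
        using convex_onD[OF P1, of s xt y] s by (simp add: z algebra_simps)
      then have "\<gamma> * (a \<bullet> ?z + P1 ?z) \<le> \<gamma> * (a \<bullet> ?z + (P1 xt + s * (P1 y - P1 xt)))"
        using pos by simp
      moreover have zk: "?z - xk = (xt - xk) + s *\<^sub>R d" by simp
      have nz: "(norm (?z - xk))\<^sup>2 = (norm (xt - xk))\<^sup>2 + 2 * s * ((xt - xk) \<bullet> d) + s\<^sup>2 * (norm d)\<^sup>2"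
        using dot_norm[of "xt - xk" "s *\<^sub>R d"] unfolding zk by (simp add: power_mult_distrib)
      have "Lt / (2 * m) * (norm (?z - xk))\<^sup>2
          = Lt / (2 * m) * (norm (xt - xk))\<^sup>2 + s * ((Lt / m) * ((xt - xk) \<bullet> d)) + s * (s * B)"
        unfolding nz B_def by (simp add: power2_eq_square algebra_simps add_divide_distrib diff_divide_distrib)
      ultimately have "0 \<le> s * (A + s * B)"
        by (simp add: J_def A_def inner_simps algebra_simps)
      then show ?thesis using s by (simp add: zero_le_mult_iff)
    qed
    note small = this
    have "0 \<le> A"
    proof (rule LIMSEQ_le_const)
      show "(\<lambda>n. A + inverse (real (Suc n)) * B) \<longlonglongrightarrow> A"
        by (rule tendsto_eq_rhs, (rule tendsto_intros LIMSEQ_inverse_real_of_nat)+) simp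
      show "\<exists>N. \<forall>n\<ge>N. 0 \<le> A + inverse (real (Suc n)) * B"
        by (intro exI allI impI small) (auto simp: field_simps)
    qed
    moreover define W where "W = b \<bullet> d + (Lt / m) * ((xt - xk) \<bullet> d)"
    have "q \<bullet> d = a \<bullet> d + W / \<gamma>"
      by (simp add: q_def W_def inner_add_left divide_inverse_commute)
    then have "\<gamma> * (q \<bullet> d) = \<gamma> * (a \<bullet> d) + W"
      using pos by (simp add: distrib_left)
    then have "A = \<gamma> * (P1 y + q \<bullet> d - P1 xt)"
      by (simp add: A_def W_def distrib_left right_diff_distrib)
    ultimately have "0 \<le> P1 y + q \<bullet> d - P1 xt" using pos by (simp add: zero_le_mult_iff)
    then show ?thesis by (simp add: d_def)
  qed
  from constrained_minimum_subgradient[OF P1 C(1) \<open>xt \<in> C\<close> this]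
  obtain p n where pn: "p \<in> subdiff (\<lambda>z. ereal (P1 z)) xt" "n \<in> normal_cone C xt" "q + p + n = 0"
    by blast
  have "\<gamma> *\<^sub>R n \<in> normal_cone C xt"
    using pn(2) \<open>xt \<in> C\<close> pos by (simp add: mem_normal_cone_iff mult_nonneg_nonpos)
  moreover have "\<gamma> *\<^sub>R (a + p) + b + (Lt / m) *\<^sub>R (xt - xk) + \<gamma> *\<^sub>R n = \<gamma> *\<^sub>R (q + p + n)"
    using pos by (simp add: q_def scaleR_add_right)
  ultimately show ?thesis
    using that[OF \<open>xt \<in> C\<close> pn(1)] pn(3) by (simp add: a_def b_def)
qed

lemma sufficient_decrease_iff:
  assumes "x \<in> C" "y \<in> C"
  shows "sufficient_decrease (objective C f P1 P2) G c1 \<gamma> m x y \<longleftrightarrow>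
    \<gamma> * (f y + P1 y - P2 y) + G y
      \<le> \<gamma> * (f x + P1 x - P2 x) + G x - c1 / (2 * m) * (norm (y - x))\<^sup>2"
  using assms by (simp add: sufficient_decrease_def objective_def delta_def)

section \<open>The smoothed constraint\<close>

locale smoothed_problem =
  fixes C :: "'a::euclidean_space set"
    and f P1 P2 :: "'a \<Rightarrow> real"
    and c :: "'a \<Rightarrow> 'b::euclidean_space"
    and h :: "'b \<Rightarrow> real"
    and hs :: "real \<Rightarrow> 'b \<Rightarrow> real"
    and \<phi>s :: "real \<Rightarrow> real \<Rightarrow> real"
    and Lf Lc Mc Mh \<alpha>1h \<alpha>2h \<alpha>31h \<alpha>32h \<alpha>4h \<alpha>1\<phi> \<alpha>2\<phi> \<alpha>31\<phi> \<alpha>32\<phi> \<alpha>4\<phi> :: real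
  assumes problem: "standing_assms C f P1 P2 c h Lf Lc Mc Mh"
    and hs: "smoothing_approx h hs \<alpha>1h \<alpha>2h \<alpha>31h \<alpha>32h" and hs_mono: "smoothing_monotone hs \<alpha>4h"
    and \<phi>s: "smoothing_approx pos_part \<phi>s \<alpha>1\<phi> \<alpha>2\<phi> \<alpha>31\<phi> \<alpha>32\<phi>"
    and \<phi>s_mono: "smoothing_monotone \<phi>s \<alpha>4\<phi>"
begin

definition gs :: "real \<Rightarrow> 'a \<Rightarrow> real" where
  "gs m y = \<phi>s m (hs m (c y))"

definition slope :: "real \<Rightarrow> 'a \<Rightarrow> real" where
  "slope m y = grad (\<phi>s m) (hs m (c y))"

definition penalty_grad :: "real \<Rightarrow> 'b \<Rightarrow> 'b" where
  "penalty_grad m y = grad (\<phi>s m) (hs m y) *\<^sub>R grad (hs m) y"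

text \<open>
  This is \<open>\<alpha>\<^sub>1 + \<alpha>\<^sub>2 / m\<close>, the Lipschitz constant of the gradient of \<open>\<phi>\<^sub>m \<circ> h\<^sub>m\<close>; \<open>Lsm m\<close> below
  is the constant \<open>L\<^sub>m\<close> of the descent inequality for \<open>gs m\<close>.
\<close>

definition penalty_lip :: "real \<Rightarrow> real" where
  "penalty_lip m = \<alpha>1h + Mh\<^sup>2 * \<alpha>1\<phi> + (\<alpha>2h + Mh\<^sup>2 * \<alpha>2\<phi>) / m"

definition Lsm :: "real \<Rightarrow> real" where
  "Lsm m = Mh * Lc + penalty_lip m * Mc\<^sup>2"

lemma C: "compact C" "convex C"
  and f: "\<And>x. f differentiable (at x)" "Lf > 0" "Lf-lipschitz_on C (grad f)"
  and c: "\<And>x. c differentiable (at x)" "continuous_on UNIV (Df c)" "Lc-lipschitz_on C (Df c)"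
    "Lc \<ge> 0" "Mc > 0" "Mc-lipschitz_on C c"
  and P1: "convex_on UNIV P1" and P2: "convex_on UNIV P2"
  and h: "Mh > 0" "Mh-lipschitz_on UNIV h"
  using problem by (auto simp: standing_assms_def cont_diff_def)

lemma \<alpha>_pos: "\<alpha>1h \<ge> 0" "\<alpha>2h > 0" "\<alpha>31h + \<alpha>32h > 0" "\<alpha>1\<phi> \<ge> 0" "\<alpha>2\<phi> > 0" "\<alpha>31\<phi> + \<alpha>32\<phi> > 0"
    "\<alpha>4h \<ge> 0" "\<alpha>4\<phi> \<ge> 0"
  using hs \<phi>s hs_mono \<phi>s_mono by (auto simp: smoothing_approx_def smoothing_monotone_def)

context
  fixes m :: real
  assumes m: "m > 0"
begin

lemma hs_diff: "hs m differentiable (at y)" and \<phi>s_diff: "\<phi>s m differentiable (at s)"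
  using hs \<phi>s m by (auto simp: smoothing_approx_def cont_diff_def)

lemma hs_bounds: "h y - \<alpha>31h * m \<le> hs m y" "hs m y \<le> h y + \<alpha>32h * m"
  using hs m by (auto simp: smoothing_approx_def)

lemma slope_bounds: "0 \<le> slope m x" "slope m x \<le> 1"
  unfolding slope_def by (rule smoothed_pos_part_slope[OF \<phi>s m])+

lemma norm_grad_hs: "norm (grad (hs m) y) \<le> Mh"
  by (rule smoothing_grad_bound[OF hs m h(2)])

lemma hs_lipschitz: "\<bar>hs m y - hs m z\<bar> \<le> Mh * norm (y - z)"
proof -
  have "hs m y - hs m z \<le> Mh * norm (y - z)" for y z
  proof -
    have "hs m z \<ge> hs m y + grad (hs m) y \<bullet> (z - y)"
      using hs m hs_diff by (intro gradient_inequality) (auto simp: smoothing_approx_def)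
    moreover have "grad (hs m) y \<bullet> (y - z) \<le> norm (grad (hs m) y) * norm (y - z)"
      by (rule norm_cauchy_schwarz)
    moreover have "norm (grad (hs m) y) * norm (y - z) \<le> Mh * norm (y - z)"
      by (intro mult_right_mono norm_grad_hs) simp
    ultimately show ?thesis by (simp add: inner_diff_right)
  qed
  from this[of y z] this[of z y] show ?thesis by (simp add: abs_le_iff norm_minus_commute)
qed

lemma penalty_gderiv: "GDERIV (\<lambda>y. \<phi>s m (hs m y)) y :> penalty_grad m y"
  using GDERIV_DERIV_compose[of "hs m" y "grad (hs m) y" "\<phi>s m" "grad (\<phi>s m) (hs m y)"]
    GDERIV_grad[OF hs_diff[of y]] GDERIV_grad[OF \<phi>s_diff[of "hs m y"]]
  by (simp add: penalty_grad_def)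

lemma norm_penalty_grad: "norm (penalty_grad m y) \<le> Mh"
proof -
  have "\<bar>grad (\<phi>s m) (hs m y)\<bar> * norm (grad (hs m) y) \<le> 1 * Mh"
    using smoothed_pos_part_slope[OF \<phi>s m] norm_grad_hs by (intro mult_mono) auto
  then show ?thesis by (simp add: penalty_grad_def)
qed

text \<open>
  The product rule: the slope lies in the unit interval and \<open>grad (hs m)\<close> has norm at most \<open>Mh\<close>,
  the latter used once as a factor and once as the Lipschitz constant of \<open>hs m\<close> inside the slope.
\<close>

lemma penalty_grad_lipschitz: "(penalty_lip m)-lipschitz_on UNIV (penalty_grad m)"
proof (rule lipschitz_onI)
  fix y z
  let ?p = "grad (\<phi>s m)" and ?h = "grad (hs m)"
  have p: "\<bar>?p (hs m y) - ?p (hs m z)\<bar> \<le> (\<alpha>1\<phi> + \<alpha>2\<phi> / m) * (Mh * norm (y - z))"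
  proof -
    have "\<bar>?p (hs m y) - ?p (hs m z)\<bar> \<le> (\<alpha>1\<phi> + \<alpha>2\<phi> / m) * \<bar>hs m y - hs m z\<bar>"
      using \<phi>s m lipschitz_onD[of "\<alpha>1\<phi> + \<alpha>2\<phi> / m" UNIV ?p "hs m y" "hs m z"]
      by (simp add: smoothing_approx_def dist_real_def)
    also have "\<dots> \<le> (\<alpha>1\<phi> + \<alpha>2\<phi> / m) * (Mh * norm (y - z))"
      using \<alpha>_pos m by (intro mult_left_mono hs_lipschitz) auto
    finally show ?thesis .
  qed
  have q: "norm (?h y - ?h z) \<le> (\<alpha>1h + \<alpha>2h / m) * norm (y - z)"
    using hs m lipschitz_onD[of "\<alpha>1h + \<alpha>2h / m" UNIV ?h y z]
    by (simp add: smoothing_approx_def dist_norm)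
  have decomp: "penalty_grad m y - penalty_grad m z =
      (?p (hs m y) - ?p (hs m z)) *\<^sub>R ?h y + ?p (hs m z) *\<^sub>R (?h y - ?h z)"
    by (simp add: penalty_grad_def algebra_simps)
  have "norm (penalty_grad m y - penalty_grad m z)
      \<le> \<bar>?p (hs m y) - ?p (hs m z)\<bar> * norm (?h y) + \<bar>?p (hs m z)\<bar> * norm (?h y - ?h z)"
    unfolding decomp by (rule order_trans[OF norm_triangle_ineq]) simp
  also have "\<dots> \<le> (\<alpha>1\<phi> + \<alpha>2\<phi> / m) * (Mh * norm (y - z)) * Mh + 1 * ((\<alpha>1h + \<alpha>2h / m) * norm (y - z))"
  proof (rule add_mono)
    have "0 \<le> (\<alpha>1\<phi> + \<alpha>2\<phi> / m) * (Mh * norm (y - z))"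
      using \<alpha>_pos m h(1) by simp
    then show "\<bar>?p (hs m y) - ?p (hs m z)\<bar> * norm (?h y) \<le> (\<alpha>1\<phi> + \<alpha>2\<phi> / m) * (Mh * norm (y - z)) * Mh"
      by (rule mult_mono[OF p norm_grad_hs]) simp
    have "\<bar>?p (hs m z)\<bar> \<le> 1"
      using smoothed_pos_part_slope[OF \<phi>s m] by simp
    then show "\<bar>?p (hs m z)\<bar> * norm (?h y - ?h z) \<le> 1 * ((\<alpha>1h + \<alpha>2h / m) * norm (y - z))"
      by (rule mult_mono[OF _ q]) simp_all
  qed
  also have "\<dots> = penalty_lip m * norm (y - z)"
    using m by (simp add: penalty_lip_def field_simps power2_eq_square)
  finally show "dist (penalty_grad m y) (penalty_grad m z) \<le> penalty_lip m * dist y z"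
    by (simp add: dist_norm)
next
  show "penalty_lip m \<ge> 0"
    using \<alpha>_pos m by (simp add: penalty_lip_def)
qed

lemma penalty_lip_nonneg: "penalty_lip m \<ge> 0"
  by (rule lipschitz_on_nonneg[OF penalty_grad_lipschitz])

lemma Lsm_pos: "Lsm m > 0"
proof -
  have "(\<alpha>2h + Mh\<^sup>2 * \<alpha>2\<phi>) / m > 0" using \<alpha>_pos m by (simp add: add_pos_nonneg)
  then have "penalty_lip m > 0" using \<alpha>_pos by (simp add: penalty_lip_def add_nonneg_pos)
  then show ?thesis using c h by (simp add: Lsm_def add_nonneg_pos)
qed

lemma gs_gderiv: "GDERIV (gs m) x :> Df_adj c x (penalty_grad m (c x))"
proof -
  have "((\<lambda>x. \<phi>s m (hs m (c x))) has_derivative (\<lambda>v. Df c x v \<bullet> penalty_grad m (c x))) (at x)"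
    using has_derivative_compose[OF has_derivative_Df[OF c(1)] penalty_gderiv[unfolded gderiv_def]] .
  then show ?thesis
    unfolding gderiv_def by (simp add: gs_def[abs_def] inner_Df_adj)
qed

lemma grad_gs: "grad (gs m) x = Df_adj c x (penalty_grad m (c x))"
  by (rule grad_eqI[OF gs_gderiv])

lemma grad_gs_slope: "grad (gs m) x = slope m x *\<^sub>R Df_adj c x (grad (hs m) (c x))"
  by (simp add: grad_gs penalty_grad_def slope_def Df_adj_scaleR)

text \<open>
  Descent for \<open>\<phi>\<^sub>\<mu> \<circ> h\<^sub>\<mu>\<close> between \<open>c x\<close> and \<open>c y\<close>, followed by descent for the real function
  \<open>penalty_grad m (c x) \<bullet> c\<close>. Only values of \<open>c\<close> on \<open>C\<close> and increments of \<open>Dc\<close> on \<open>C\<close> enter,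
  and the assumptions control both.
\<close>

lemma gs_descent:
  assumes x: "x \<in> C" and y: "y \<in> C"
  shows "gs m y \<le> gs m x + grad (gs m) x \<bullet> (y - x) + Lsm m / 2 * (norm (y - x))\<^sup>2"
proof -
  let ?w = "penalty_grad m (c x)"
  let ?H = "\<lambda>y. \<phi>s m (hs m y)"
  have gradH: "grad ?H = penalty_grad m"
    using grad_eqI[OF penalty_gderiv] by blast
  have "?H (c y) \<le> ?H (c x) + ?w \<bullet> (c y - c x) + penalty_lip m / 2 * (norm (c y - c x))\<^sup>2"
    using gradient_descent_inequality[of UNIV "c x" "c y" ?H "penalty_lip m"]
      penalty_grad_lipschitz penalty_gderiv
    by (auto simp: gradH gderiv_def differentiable_def)
  moreover have "(norm (c y - c x))\<^sup>2 \<le> (Mc * norm (y - x))\<^sup>2"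
    using lipschitz_onD[OF c(6) y x] by (intro power_mono) (auto simp: dist_norm)
  then have "penalty_lip m / 2 * (norm (c y - c x))\<^sup>2 \<le> penalty_lip m / 2 * (Mc * norm (y - x))\<^sup>2"
    using penalty_lip_nonneg by (intro mult_left_mono) auto
  moreover have "?w \<bullet> c y \<le> ?w \<bullet> c x + ?w \<bullet> Df c x (y - x) + (Mh * Lc) / 2 * (norm (y - x))\<^sup>2"
  proof (rule descent_inequality[OF C(2) x y, where F' = "\<lambda>z v. ?w \<bullet> Df c z v"])
    fix z assume z: "z \<in> C"
    show "((\<lambda>x. ?w \<bullet> c x) has_derivative (\<lambda>v. ?w \<bullet> Df c z v)) (at z)"
      by (intro has_derivative_inner_right has_derivative_Df c(1))
    have "?w \<bullet> (Df c z - Df c x) (y - x) \<le> norm ?w * norm ((Df c z - Df c x) (y - x))"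
      by (rule norm_cauchy_schwarz)
    also have "\<dots> \<le> Mh * (Lc * norm (z - x) * norm (y - x))"
    proof (intro mult_mono norm_penalty_grad)
      have "norm ((Df c z - Df c x) (y - x)) \<le> norm (Df c z - Df c x) * norm (y - x)"
        by (rule norm_blinfun)
      also have "\<dots> \<le> Lc * norm (z - x) * norm (y - x)"
        using lipschitz_onD[OF c(3) z x] by (intro mult_right_mono) (auto simp: dist_norm)
      finally show "norm ((Df c z - Df c x) (y - x)) \<le> Lc * norm (z - x) * norm (y - x)" .
    qed (use h in auto)
    finally show "?w \<bullet> Df c z (y - x) - ?w \<bullet> Df c x (y - x) \<le> Mh * Lc * norm (z - x) * norm (y - x)"
      by (simp add: blinfun.diff_left inner_diff_right mult_ac)
  qed
  moreover have "grad (gs m) x \<bullet> (y - x) = ?w \<bullet> Df c x (y - x)"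
    by (simp add: grad_gs inner_commute[of "Df_adj _ _ _"] inner_Df_adj inner_commute)
  moreover have "Lsm m / 2 * (norm (y - x))\<^sup>2
      = Mh * Lc / 2 * (norm (y - x))\<^sup>2 + penalty_lip m / 2 * (Mc * norm (y - x))\<^sup>2"
    by (simp add: Lsm_def power_mult_distrib distrib_right add_divide_distrib)
  ultimately show ?thesis
    unfolding gs_def inner_diff_right[of "penalty_grad m (c x)"] by linarith
qed

text \<open>
  Here \<open>e\<close> is the projection of the gradient difference onto the directions parallel to the
  affine hull of \<open>C\<close>, where \<open>Dc\<close> is bounded by \<open>Mc\<close>.
\<close>

lemma grad_gs_tangential_lipschitz:
  assumes x: "x \<in> C" and y: "y \<in> C"
  obtains e n where "grad (gs m) x - grad (gs m) y = e + n"
    "norm e \<le> Lsm m * norm (x - y)" "\<And>z. z \<in> C \<Longrightarrow> n \<bullet> (z - y) = 0"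
proof -
  define D where "D = grad (gs m) x - grad (gs m) y"
  obtain e n where e: "e \<in> span ((\<lambda>z. z - y) ` C)"
    and n: "\<And>w. w \<in> span ((\<lambda>z. z - y) ` C) \<Longrightarrow> orthogonal n w" and D: "D = e + n"
    using orthogonal_subspace_decomp_exists[of "(\<lambda>z. z - y) ` C" D] by blast
  let ?u = "penalty_grad m (c x)" and ?w = "penalty_grad m (c y)"
  have "norm e * norm e = e \<bullet> D"
    using n[OF e] by (simp add: D inner_add_right orthogonal_def inner_commute power2_norm_eq_inner flip: power2_eq_square)
  also have "\<dots> = Df c x e \<bullet> (?u - ?w) + (Df c x - Df c y) e \<bullet> ?w"
    by (simp add: D_def grad_gs inner_diff_right inner_Df_adj blinfun.diff_left inner_diff_left)
  also have "\<dots> \<le> norm (Df c x e) * norm (?u - ?w) + norm ((Df c x - Df c y) e) * norm ?w"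
    by (intro add_mono norm_cauchy_schwarz)
  also have "\<dots> \<le> (Mc * norm e) * (penalty_lip m * (Mc * norm (x - y))) + (Lc * norm (x - y) * norm e) * Mh"
  proof (intro add_mono mult_mono norm_penalty_grad)
    show "norm (Df c x e) \<le> Mc * norm e"
      using tangential_derivative_bound[OF C(2) c(6) c(1,2) x y e] .
    have "norm (?u - ?w) \<le> penalty_lip m * norm (c x - c y)"
      using lipschitz_onD[OF penalty_grad_lipschitz, of "c x" "c y"] by (simp add: dist_norm)
    also have "\<dots> \<le> penalty_lip m * (Mc * norm (x - y))"
      using lipschitz_onD[OF c(6) x y] penalty_lip_nonneg by (intro mult_left_mono) (auto simp: dist_norm)
    finally show "norm (?u - ?w) \<le> penalty_lip m * (Mc * norm (x - y))" .
    have "norm ((Df c x - Df c y) e) \<le> norm (Df c x - Df c y) * norm e"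
      by (rule norm_blinfun)
    also have "\<dots> \<le> Lc * norm (x - y) * norm e"
      using lipschitz_onD[OF c(3) x y] by (intro mult_right_mono) (auto simp: dist_norm)
    finally show "norm ((Df c x - Df c y) e) \<le> Lc * norm (x - y) * norm e" .
  qed (use c in auto)
  also have "\<dots> = (Lsm m * norm (x - y)) * norm e"
    by (simp add: Lsm_def power2_eq_square algebra_simps)
  finally have "norm e \<le> Lsm m * norm (x - y)"
    using Lsm_pos by (cases "e = 0") auto
  moreover have "n \<bullet> (z - y) = 0" if "z \<in> C" for z
    using n[OF span_base, of "z - y"] that by (auto simp: orthogonal_def)
  ultimately show ?thesis by (rule that[OF D[unfolded D_def]])
qed

text \<open>
  The optimality condition, tested with the step, gives a decrease of the model by
  \<open>Lt / m * (norm (xt - xk))\<^sup>2\<close>: one half of this comes from minimality, the other from strong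
  convexity. The descent inequalities for \<open>f\<close> and \<open>gs m\<close> and the subgradient inequality for \<open>P2\<close>
  transfer it to the merit function. This is why \<open>2 * Lt\<close>, and not just \<open>Lt\<close>, appears on the
  right, and why doubling never overshoots \<open>M_L\<close>.
\<close>

lemma trial_point_accepted:
  assumes trial: "is_trial_point C f P1 (gs m) \<gamma> m xk \<xi> Lt xt" and xk: "xk \<in> C"
    and \<xi>: "\<xi> \<in> subdiff (\<lambda>y. ereal (P2 y)) xk" and pos: "\<gamma> > 0"
    and Lt: "c1 + m * \<gamma> * Lf + m * Lsm m \<le> 2 * Lt"
  shows "sufficient_decrease (objective C f P1 P2) (gs m) c1 \<gamma> m xk xt"
proof -
  obtain p n where xt: "xt \<in> C" and p: "p \<in> subdiff (\<lambda>z. ereal (P1 z)) xt"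
    and n: "n \<in> normal_cone C xt"
    and stat: "\<gamma> *\<^sub>R (grad f xk - \<xi> + p) + grad (gs m) xk + (Lt / m) *\<^sub>R (xt - xk) + n = 0"
    by (rule trial_point_stationary[OF trial C(2) xk P1 pos])
  let ?d = "xt - xk"
  have "0 = (\<gamma> *\<^sub>R (grad f xk - \<xi> + p) + grad (gs m) xk + (Lt / m) *\<^sub>R (xt - xk) + n) \<bullet> ?d"
    by (simp add: stat)
  also have "\<dots> = \<gamma> * (grad f xk \<bullet> ?d - \<xi> \<bullet> ?d + p \<bullet> ?d) + grad (gs m) xk \<bullet> ?d
      + Lt / m * (norm ?d)\<^sup>2 + n \<bullet> ?d"
    by (simp add: inner_add_left inner_diff_left power2_norm_eq_inner)
  finally have eq: "\<gamma> * (grad f xk \<bullet> ?d - \<xi> \<bullet> ?d + p \<bullet> ?d) + grad (gs m) xk \<bullet> ?d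
      + Lt / m * (norm ?d)\<^sup>2 + n \<bullet> ?d = 0" by simp
  have "n \<bullet> ?d \<ge> 0"
    using n xt xk by (auto simp: mem_normal_cone_iff inner_diff_right)
  moreover have "p \<bullet> ?d \<ge> P1 xt - P1 xk"
    using p unfolding mem_eps_subdiff_real_iff by (auto simp: inner_diff_right algebra_simps dest: spec[of _ xk])
  moreover have "P2 xt - P2 xk \<ge> \<xi> \<bullet> ?d"
    using \<xi> unfolding mem_eps_subdiff_real_iff by (auto simp: algebra_simps dest: spec[of _ xt])
  moreover have "f xt \<le> f xk + grad f xk \<bullet> ?d + Lf / 2 * (norm ?d)\<^sup>2"
    by (rule gradient_descent_inequality[OF C(2) xk xt f(1,3)])
  ultimately have 1: "(f xt + P1 xt - P2 xt) - (f xk + P1 xk - P2 xk)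
      \<le> grad f xk \<bullet> ?d - \<xi> \<bullet> ?d + p \<bullet> ?d + Lf / 2 * (norm ?d)\<^sup>2" by linarith
  have 2: "\<gamma> * ((f xt + P1 xt - P2 xt) - (f xk + P1 xk - P2 xk))
      \<le> \<gamma> * (grad f xk \<bullet> ?d - \<xi> \<bullet> ?d + p \<bullet> ?d) + \<gamma> * (Lf / 2 * (norm ?d)\<^sup>2)"
    using mult_left_mono[OF 1, of \<gamma>] pos by (simp add: distrib_left)
  have "(c1 / (2 * m) + \<gamma> * Lf / 2 + Lsm m / 2) * (norm ?d)\<^sup>2 \<le> Lt / m * (norm ?d)\<^sup>2"
  proof (rule mult_right_mono)
    have "c1 / (2 * m) + \<gamma> * Lf / 2 + Lsm m / 2 = (c1 + m * \<gamma> * Lf + m * Lsm m) / (2 * m)"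
      using m by (simp add: field_simps)
    also have "\<dots> \<le> 2 * Lt / (2 * m)"
      using Lt m by (intro divide_right_mono) auto
    finally show "c1 / (2 * m) + \<gamma> * Lf / 2 + Lsm m / 2 \<le> Lt / m" by simp
  qed simp
  then have 3: "c1 / (2 * m) * (norm ?d)\<^sup>2 + \<gamma> * (Lf / 2 * (norm ?d)\<^sup>2) + Lsm m / 2 * (norm ?d)\<^sup>2
      \<le> Lt / m * (norm ?d)\<^sup>2"
    by (simp add: distrib_right)
  show ?thesis
    unfolding sufficient_decrease_iff[OF xk xt]
    using eq 2 3 gs_descent[OF xk xt] \<open>n \<bullet> ?d \<ge> 0\<close> unfolding right_diff_distrib by linarith
qed

text \<open>
  The optimality condition with \<open>gs m\<close> differentiated at the new point, which is where
  the KKT conditions are wanted. The part of the gradient difference that is not controlled by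
  the step is orthogonal to \<open>C - xt\<close> and joins the normal vector.
\<close>

lemma trial_point_residual:
  assumes trial: "is_trial_point C f P1 (gs m) \<gamma> m xk \<xi> Lt xt" and xk: "xk \<in> C"
    and pos: "\<gamma> > 0" "Lt \<ge> 0"
  obtains p n where "xt \<in> C" "p \<in> subdiff (\<lambda>z. ereal (P1 z)) xt" "n \<in> normal_cone C xt"
    "norm (\<gamma> *\<^sub>R (grad f xk - \<xi> + p) + grad (gs m) xt + n) \<le> (Lsm m + Lt / m) * norm (xt - xk)"
proof -
  obtain p n where xt: "xt \<in> C" and p: "p \<in> subdiff (\<lambda>z. ereal (P1 z)) xt"
    and n: "n \<in> normal_cone C xt"
    and stat: "\<gamma> *\<^sub>R (grad f xk - \<xi> + p) + grad (gs m) xk + (Lt / m) *\<^sub>R (xt - xk) + n = 0"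
    by (rule trial_point_stationary[OF trial C(2) xk P1 pos(1)])
  obtain e n' where en: "grad (gs m) xk - grad (gs m) xt = e + n'"
    and e: "norm e \<le> Lsm m * norm (xk - xt)" and n': "\<And>z. z \<in> C \<Longrightarrow> n' \<bullet> (z - xt) = 0"
    by (rule grad_gs_tangential_lipschitz[OF xk xt]) blast
  have "n + n' \<in> normal_cone C xt"
    using n n' xt by (simp add: mem_normal_cone_iff inner_add_left)
  moreover have "\<gamma> *\<^sub>R (grad f xk - \<xi> + p) + grad (gs m) xt + (n + n')
      = - (e + (Lt / m) *\<^sub>R (xt - xk))"
    using stat en by (simp add: algebra_simps eq_neg_iff_add_eq_0)
  then have "norm (\<gamma> *\<^sub>R (grad f xk - \<xi> + p) + grad (gs m) xt + (n + n'))
      \<le> norm e + norm ((Lt / m) *\<^sub>R (xt - xk))"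
    by (simp only: norm_minus_cancel norm_triangle_ineq)
  then have "norm (\<gamma> *\<^sub>R (grad f xk - \<xi> + p) + grad (gs m) xt + (n + n'))
      \<le> (Lsm m + Lt / m) * norm (xt - xk)"
    using e pos m by (simp add: norm_minus_commute distrib_right)
  ultimately show ?thesis using that xt p by blast
qed

end

lemma gs_mono:
  assumes "0 < m" "m \<le> m'"
  shows "gs m y \<le> gs m' y + (\<alpha>4h + \<alpha>4\<phi>) * (m' - m)"
proof -
  have "hs m (c y) \<le> hs m' (c y) + \<alpha>4h * (m' - m)"
    using hs_mono assms by (simp add: smoothing_monotone_def)
  then have "\<phi>s m (hs m (c y)) \<le> \<phi>s m (hs m' (c y)) + \<alpha>4h * (m' - m)"
    using assms \<alpha>_pos by (intro smoothed_pos_part_increment[OF \<phi>s]) auto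
  also have "\<phi>s m (hs m' (c y)) \<le> \<phi>s m' (hs m' (c y)) + \<alpha>4\<phi> * (m' - m)"
    using \<phi>s_mono assms by (simp add: smoothing_monotone_def)
  finally show ?thesis by (simp add: gs_def algebra_simps)
qed

text \<open>
  The constant \<open>Lsm m\<close> blows up as \<open>m\<close> tends to zero, but \<open>m * Lsm m\<close> is affine and nondecreasing
  in \<open>m\<close>.
\<close>

lemma times_Lsm_mono:
  assumes "0 < m" "m \<le> m'"
  shows "m * Lsm m \<le> m' * Lsm m'"
proof -
  have "r * Lsm r = r * (Mh * Lc + (\<alpha>1h + Mh\<^sup>2 * \<alpha>1\<phi>) * Mc\<^sup>2) + (\<alpha>2h + Mh\<^sup>2 * \<alpha>2\<phi>) * Mc\<^sup>2" if "r > 0" for r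
    using that by (simp add: Lsm_def penalty_lip_def field_simps)
  moreover have "m * (Mh * Lc + (\<alpha>1h + Mh\<^sup>2 * \<alpha>1\<phi>) * Mc\<^sup>2) \<le> m' * (Mh * Lc + (\<alpha>1h + Mh\<^sup>2 * \<alpha>1\<phi>) * Mc\<^sup>2)"
    using assms c h \<alpha>_pos by (intro mult_right_mono add_nonneg_nonneg mult_nonneg_nonneg) auto
  ultimately show ?thesis using assms by simp
qed

end

section \<open>Runs of the algorithm\<close>

locale sESQM = smoothed_problem +
  fixes Llow Lup c1 c2 :: real and gh :: "nat \<Rightarrow> real" and x \<xi> :: "nat \<Rightarrow> 'a"
    and L0 L \<mu> :: "nat \<Rightarrow> real" and t :: "nat \<Rightarrow> nat"
  assumes run: "sESQM_run C f P1 P2 c hs \<phi>s (\<alpha>31\<phi> + \<alpha>32\<phi>) Llow Lup c1 c2 gh x \<xi> L0 L t \<mu>"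
begin

definition step :: "nat \<Rightarrow> real" where
  "step k = norm (x (Suc k) - x k)"

definition M_L :: real where
  "M_L = max Lup (c1 + gh 0 * \<mu> 0 * Lf + \<mu> 0 * Lsm (\<mu> 0))"

lemma inputs: "x 0 \<in> C" "Llow > 0" "Lup \<ge> Llow" "c1 > 0" "c2 > 0" "gh j > 0" "t 0 = 0"
  and gh_antimono: "i \<le> j \<Longrightarrow> gh j \<le> gh i"
  using run unfolding sESQM_run_def monotone_on_def by (auto simp: le_less)

lemma iteration:
  shows "\<xi> k \<in> subdiff (\<lambda>y. ereal (P2 y)) (x k)" "Llow \<le> L0 k" "L0 k \<le> Lup"
    and "\<exists>i. L k = 2 ^ i * L0 k \<and> is_trial_point C f P1 (gs (\<mu> k)) (gh (t k)) (\<mu> k) (x k) (\<xi> k) (L k) (x (Suc k)) \<and>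
      sufficient_decrease (objective C f P1 P2) (gs (\<mu> k)) c1 (gh (t k)) (\<mu> k) (x k) (x (Suc k)) \<and>
      (\<forall>j<i. \<exists>y. is_trial_point C f P1 (gs (\<mu> k)) (gh (t k)) (\<mu> k) (x k) (\<xi> k) (2 ^ j * L0 k) y \<and>
        \<not> sufficient_decrease (objective C f P1 P2) (gs (\<mu> k)) c1 (gh (t k)) (\<mu> k) (x k) y)"
    and "t (Suc k) = (if hs (\<mu> k) (c (x (Suc k))) > 2 * (\<alpha>31\<phi> + \<alpha>32\<phi>) * \<mu> k
       \<and> step k \<le> c2 * \<mu> k * gh (t k) then t k + 1 else t k)"
    and "\<mu> (Suc k) \<in> {0<..\<mu> k}"
proof -
  have gs_eq: "gs m = (\<lambda>y. \<phi>s m (hs m (c y)))" for m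
    by (simp add: fun_eq_iff gs_def)
  \<comment> \<open>The last of the ten conjuncts describes the iterations.\<close>
  note it = run[unfolded sESQM_run_def Let_def, THEN conjunct2, THEN conjunct2, THEN conjunct2,
      THEN conjunct2, THEN conjunct2, THEN conjunct2, THEN conjunct2, THEN conjunct2, THEN conjunct2,
      THEN spec[of _ k], folded gs_eq step_def]
  show "\<xi> k \<in> subdiff (\<lambda>y. ereal (P2 y)) (x k)" "Llow \<le> L0 k" "L0 k \<le> Lup"
    using it by auto
  show "\<exists>i. L k = 2 ^ i * L0 k \<and> is_trial_point C f P1 (gs (\<mu> k)) (gh (t k)) (\<mu> k) (x k) (\<xi> k) (L k) (x (Suc k)) \<and>
      sufficient_decrease (objective C f P1 P2) (gs (\<mu> k)) c1 (gh (t k)) (\<mu> k) (x k) (x (Suc k)) \<and>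
      (\<forall>j<i. \<exists>y. is_trial_point C f P1 (gs (\<mu> k)) (gh (t k)) (\<mu> k) (x k) (\<xi> k) (2 ^ j * L0 k) y \<and>
        \<not> sufficient_decrease (objective C f P1 P2) (gs (\<mu> k)) c1 (gh (t k)) (\<mu> k) (x k) y)"
    using it by (elim conjE)
  show "t (Suc k) = (if hs (\<mu> k) (c (x (Suc k))) > 2 * (\<alpha>31\<phi> + \<alpha>32\<phi>) * \<mu> k
       \<and> step k \<le> c2 * \<mu> k * gh (t k) then t k + 1 else t k)"
    using it by (elim conjE)
  show "\<mu> (Suc k) \<in> {0<..\<mu> k}"
    using it by (elim conjE)
qed

lemma \<mu>_pos: "\<mu> k > 0"
proof (cases k)
  case 0
  then show ?thesis using run by (simp add: sESQM_run_def)
next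
  case (Suc j)
  then show ?thesis using iteration(6)[of j] by simp
qed

lemma \<mu>_Suc: "\<mu> (Suc k) \<le> \<mu> k"
  using iteration(6)[of k] by simp

lemma \<mu>_antimono: "i \<le> j \<Longrightarrow> \<mu> j \<le> \<mu> i"
  by (rule lift_Suc_antimono_le[of \<mu>, OF \<mu>_Suc])

lemma t_Suc: "t (Suc k) = t k \<or> t (Suc k) = Suc (t k)"
  using iteration(5)[of k] by simp

lemma t_mono: "i \<le> j \<Longrightarrow> t i \<le> t j"
proof (rule lift_Suc_mono_le[of t])
  show "t k \<le> t (Suc k)" for k using t_Suc[of k] by auto
qed

lemma t_le: "t k \<le> k"
proof (induction k)
  case (Suc k)
  then show ?case using t_Suc[of k] by auto
qed (simp add: inputs)

text \<open>
  Since \<open>t\<close> starts at zero and moves by at most one, a bound on \<open>t\<close> is a bound on the number of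
  updates.
\<close>

lemma t_eq_card: "t n = card {k. k < n \<and> t (Suc k) \<noteq> t k}"
proof (induction n)
  case (Suc n)
  have "{k. k < Suc n \<and> t (Suc k) \<noteq> t k} =
      (if t (Suc n) \<noteq> t n then insert n {k. k < n \<and> t (Suc k) \<noteq> t k} else {k. k < n \<and> t (Suc k) \<noteq> t k})"
    by (auto simp: less_Suc_eq)
  with Suc t_Suc[of n] show ?case by auto
qed (simp add: inputs)

lemma x_in_C: "x k \<in> C"
proof (induction k)
  case (Suc k)
  obtain Lt where "is_trial_point C f P1 (gs (\<mu> k)) (gh (t k)) (\<mu> k) (x k) (\<xi> k) Lt (x (Suc k))"
    using iteration(4)[of k] by blast
  from trial_point_stationary[OF this C(2) Suc P1 inputs(6)] show ?case by blast
qed (rule inputs)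

lemma L_pos: "L k > 0"
  using iteration(2,4)[of k] inputs(2) by (metis less_le_trans mult_pos_pos zero_less_numeral zero_less_power)

lemma M_L_pos: "M_L > 0"
  using inputs(2,3) unfolding M_L_def by linarith

lemma gh_times_\<mu>_le: "\<mu> k * gh (t k) \<le> \<mu> 0 * gh 0"
  using \<mu>_pos \<mu>_antimono gh_antimono inputs(6) by (intro mult_mono) (auto intro: less_imp_le)

lemma \<mu>_times_Lsm_le: "\<mu> k * Lsm (\<mu> k) \<le> \<mu> 0 * Lsm (\<mu> 0)"
  by (intro times_Lsm_mono \<mu>_pos \<mu>_antimono) simp

text \<open>
  If the parameter was doubled at all, half of the accepted one was rejected, so the acceptance
  criterion was not met there.
\<close>

lemma L_le: "L k \<le> M_L"
proof -
  obtain i where i: "L k = 2 ^ i * L0 k"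
    and rej: "\<And>j. j < i \<Longrightarrow> \<exists>y. is_trial_point C f P1 (gs (\<mu> k)) (gh (t k)) (\<mu> k) (x k) (\<xi> k) (2 ^ j * L0 k) y \<and>
        \<not> sufficient_decrease (objective C f P1 P2) (gs (\<mu> k)) c1 (gh (t k)) (\<mu> k) (x k) y"
    using iteration(4)[of k] by blast
  show ?thesis
  proof (cases i)
    case 0
    then show ?thesis using i iteration(3)[of k] by (simp add: M_L_def)
  next
    case (Suc j)
    have "L k = 2 * (2 ^ j * L0 k)" by (simp add: i Suc)
    also obtain y where "is_trial_point C f P1 (gs (\<mu> k)) (gh (t k)) (\<mu> k) (x k) (\<xi> k) (2 ^ j * L0 k) y"
      "\<not> sufficient_decrease (objective C f P1 P2) (gs (\<mu> k)) c1 (gh (t k)) (\<mu> k) (x k) y"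
      using rej[of j] Suc by blast
    then have "2 * (2 ^ j * L0 k) < c1 + \<mu> k * gh (t k) * Lf + \<mu> k * Lsm (\<mu> k)"
      using trial_point_accepted[OF \<mu>_pos _ x_in_C iteration(1) inputs(6)] not_le by blast
    also have "\<dots> \<le> c1 + \<mu> 0 * gh 0 * Lf + \<mu> 0 * Lsm (\<mu> 0)"
      using gh_times_\<mu>_le \<mu>_times_Lsm_le f(2) by (intro add_mono mult_right_mono) auto
    finally show ?thesis by (simp add: M_L_def mult_ac)
  qed
qed

text \<open>
  The bound is written through \<open>\<mu> k * Lsm (\<mu> k)\<close> and the ratio \<open>step k / \<mu> k\<close> because the former is
  bounded along the run and the latter is what the counting argument makes small.
\<close>

lemma residual:
  obtains p n where "p \<in> subdiff (\<lambda>z. ereal (P1 z)) (x (Suc k))" "n \<in> normal_cone C (x (Suc k))"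
    "norm (gh (t k) *\<^sub>R (grad f (x k) - \<xi> k + p)
       + slope (\<mu> k) (x (Suc k)) *\<^sub>R Df_adj c (x (Suc k)) (grad (hs (\<mu> k)) (c (x (Suc k)))) + n)
     \<le> (\<mu> k * Lsm (\<mu> k) + L k) * (step k / \<mu> k)"
proof -
  have "is_trial_point C f P1 (gs (\<mu> k)) (gh (t k)) (\<mu> k) (x k) (\<xi> k) (L k) (x (Suc k))"
    using iteration(4)[of k] by blast
  from trial_point_residual[OF \<mu>_pos this x_in_C inputs(6) less_imp_le[OF L_pos]]
  obtain p n where "p \<in> subdiff (\<lambda>z. ereal (P1 z)) (x (Suc k))" "n \<in> normal_cone C (x (Suc k))"
    and le: "norm (gh (t k) *\<^sub>R (grad f (x k) - \<xi> k + p) + grad (gs (\<mu> k)) (x (Suc k)) + n)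
      \<le> (Lsm (\<mu> k) + L k / \<mu> k) * norm (x (Suc k) - x k)"
    by blast
  moreover have "(Lsm (\<mu> k) + L k / \<mu> k) * norm (x (Suc k) - x k)
      = (\<mu> k * Lsm (\<mu> k) + L k) * (step k / \<mu> k)"
    using \<mu>_pos[of k] by (simp add: step_def field_simps)
  ultimately show ?thesis using that by (simp add: grad_gs_slope[OF \<mu>_pos])
qed

section \<open>Decrease of the potential\<close>

text \<open>
  The merit function with \<open>\<psi>\<close> shifted by a lower bound \<open>b\<close>, so that lowering the weight does not
  increase it, and with a term that pays for the change of \<open>gs\<close> when \<open>\<mu>\<close> is lowered.
\<close>

definition potential :: "real \<Rightarrow> nat \<Rightarrow> real" where
  "potential b k = gh (t k) * (f (x k) + P1 (x k) - P2 (x k) - b) + gs (\<mu> k) (x k) + (\<alpha>4h + \<alpha>4\<phi>) * \<mu> k"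

context
  fixes b :: real
  assumes b: "\<And>y. y \<in> C \<Longrightarrow> b \<le> f y + P1 y - P2 y"
begin

lemma potential_Suc:
  "potential b (Suc k) + c1 / 2 * (\<mu> k * (step k / \<mu> k)\<^sup>2) \<le> potential b k"
proof -
  let ?x = "x (Suc k)" and ?\<psi> = "\<lambda>y. f y + P1 y - P2 y"
  have "gh (t k) * ?\<psi> ?x + gs (\<mu> k) ?x
      \<le> gh (t k) * ?\<psi> (x k) + gs (\<mu> k) (x k) - c1 / (2 * \<mu> k) * (step k)\<^sup>2"
    using iteration(4)[of k] unfolding step_def
    by (subst sufficient_decrease_iff[OF x_in_C x_in_C, symmetric]) blast
  moreover have "gh (t (Suc k)) * (?\<psi> ?x - b) \<le> gh (t k) * (?\<psi> ?x - b)"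
    using b[OF x_in_C, of "Suc k"] t_mono[of k "Suc k"] by (intro mult_right_mono gh_antimono) auto
  moreover have "gs (\<mu> (Suc k)) ?x \<le> gs (\<mu> k) ?x + (\<alpha>4h + \<alpha>4\<phi>) * (\<mu> k - \<mu> (Suc k))"
    by (intro gs_mono \<mu>_pos \<mu>_antimono) simp
  moreover have "c1 / 2 * (\<mu> k * (step k / \<mu> k)\<^sup>2) = c1 / (2 * \<mu> k) * (step k)\<^sup>2"
    using \<mu>_pos[of k] by (simp add: power2_eq_square)
  ultimately show ?thesis
    unfolding potential_def right_diff_distrib by linarith
qed

lemma potential_ge: "potential b k \<ge> - (pos_part (pos_part \<alpha>31h + \<alpha>31\<phi>) * \<mu> 0)"
proof -
  have "gs (\<mu> k) (x k) \<ge> pos_part (hs (\<mu> k) (c (x k))) - \<alpha>31\<phi> * \<mu> k"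
    using \<phi>s \<mu>_pos[of k] by (simp add: smoothing_approx_def gs_def)
  moreover have "pos_part (hs (\<mu> k) (c (x k))) \<ge> 0" by (simp add: pos_part_def)
  moreover have "\<alpha>31\<phi> * \<mu> k \<le> pos_part (pos_part \<alpha>31h + \<alpha>31\<phi>) * \<mu> 0"
  proof -
    have "\<alpha>31\<phi> \<le> pos_part (pos_part \<alpha>31h + \<alpha>31\<phi>)" by (simp add: pos_part_def)
    then have "\<alpha>31\<phi> * \<mu> k \<le> pos_part (pos_part \<alpha>31h + \<alpha>31\<phi>) * \<mu> k"
      using \<mu>_pos[of k] by (intro mult_right_mono) auto
    also have "\<dots> \<le> pos_part (pos_part \<alpha>31h + \<alpha>31\<phi>) * \<mu> 0"
      by (intro mult_left_mono \<mu>_antimono) (auto simp: pos_part_def)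
    finally show ?thesis .
  qed
  moreover have "gh (t k) * (f (x k) + P1 (x k) - P2 (x k) - b) \<ge> 0"
    using b[OF x_in_C] inputs(6) by (simp add: less_imp_le)
  moreover have "(\<alpha>4h + \<alpha>4\<phi>) * \<mu> k \<ge> 0" using \<alpha>_pos \<mu>_pos[of k] by simp
  ultimately show ?thesis unfolding potential_def by linarith
qed

lemma weighted_steps_summable:
  "(\<Sum>k<n. \<mu> k * (step k / \<mu> k)\<^sup>2)
    \<le> 2 * (potential b 0 + pos_part (pos_part \<alpha>31h + \<alpha>31\<phi>) * \<mu> 0) / c1"
proof -
  have "c1 / 2 * (\<Sum>k<n. \<mu> k * (step k / \<mu> k)\<^sup>2) + potential b n \<le> potential b 0"
  proof (induction n)
    case (Suc n)
    then show ?case using potential_Suc[of n] by (simp add: distrib_left)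
  qed simp
  with potential_ge[of n] have "c1 / 2 * (\<Sum>k<n. \<mu> k * (step k / \<mu> k)\<^sup>2)
      \<le> potential b 0 + pos_part (pos_part \<alpha>31h + \<alpha>31\<phi>) * \<mu> 0" by linarith
  then show ?thesis using inputs(4) by (simp add: field_simps)
qed

end

section \<open>Lower bound for the penalty weights\<close>

text \<open>
  An update happens only at an infeasible point reached by a short step. Infeasibility makes the
  slope \<open>s\<close> exceed \<open>1 / 2\<close> and brings the point within the range of the constraint qualification;
  dividing the residual by \<open>s\<close> yields an element of the set whose distance from zero is at least
  \<open>\<eta>\<close>. Everything else in the residual carries the weight as a factor, the short step included.
\<close>

lemma penalty_update_bound:
  assumes bounds: "\<And>y. y \<in> C \<Longrightarrow> norm (grad f y) \<le> Mf"
      "\<And>y v. y \<in> C \<Longrightarrow> v \<in> subdiff (\<lambda>z. ereal (P1 z)) y \<Longrightarrow> norm v \<le> MP1"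
      "\<And>y v. y \<in> C \<Longrightarrow> v \<in> subdiff (\<lambda>z. ereal (P2 z)) y \<Longrightarrow> norm v \<le> MP2"
    and \<eta>: "\<eta> > 0"
      "\<And>y u. y \<in> C \<Longrightarrow> h (c y) \<ge> - \<eta> \<Longrightarrow> u \<in> eps_subdiff \<eta> (\<lambda>z. ereal (h z)) (c y) \<Longrightarrow>
         dist_set 0 {Df_adj c y u + n | n. n \<in> normal_cone C y} \<ge> ereal \<eta>"
    and small: "(\<alpha>31h + \<alpha>32h) * \<mu> k \<le> \<eta>" "pos_part \<alpha>32h * \<mu> k \<le> \<eta>"
    and update: "t (Suc k) \<noteq> t k"
  shows "\<eta> < gh (t k) * (2 * (Mf + MP1 + MP2 + c2 * (M_L + \<mu> 0 * Lsm (\<mu> 0))))"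
proof -
  let ?y = "x (Suc k)" and ?\<gamma> = "gh (t k)"
  define u where "u = grad (hs (\<mu> k)) (c ?y)"
  define s where "s = slope (\<mu> k) ?y"
  have infeas: "hs (\<mu> k) (c ?y) > 2 * (\<alpha>31\<phi> + \<alpha>32\<phi>) * \<mu> k" and short: "step k \<le> c2 * \<mu> k * ?\<gamma>"
    using iteration(5)[of k] update by (auto split: if_splits)
  have s: "s > 1 / 2"
    unfolding s_def slope_def by (rule smoothed_pos_part_slope_gt_half[OF \<phi>s \<mu>_pos infeas])
  have "2 * (\<alpha>31\<phi> + \<alpha>32\<phi>) * \<mu> k > 0"
    using \<alpha>_pos(6) \<mu>_pos[of k] by (intro mult_pos_pos) auto
  moreover have "\<alpha>32h * \<mu> k \<le> pos_part \<alpha>32h * \<mu> k"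
    using \<mu>_pos[of k] by (intro mult_right_mono) (auto simp: pos_part_def)
  ultimately have "h (c ?y) \<ge> - \<eta>"
    using infeas hs_bounds(2)[OF \<mu>_pos, of k "c ?y"] small(2) by linarith
  moreover have "u \<in> eps_subdiff \<eta> (\<lambda>z. ereal (h z)) (c ?y)"
    unfolding u_def by (rule smoothing_grad_eps_subgradient[OF hs \<mu>_pos small(1)])
  ultimately have dist: "dist_set 0 {Df_adj c ?y u + n | n. n \<in> normal_cone C ?y} \<ge> ereal \<eta>"
    by (rule \<eta>(2)[OF x_in_C])
  obtain p n where p: "p \<in> subdiff (\<lambda>z. ereal (P1 z)) ?y" and n: "n \<in> normal_cone C ?y"
    and res: "norm (?\<gamma> *\<^sub>R (grad f (x k) - \<xi> k + p) + s *\<^sub>R Df_adj c ?y u + n)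
      \<le> (\<mu> k * Lsm (\<mu> k) + L k) * (step k / \<mu> k)"
    unfolding s_def u_def by (rule residual)
  have "n /\<^sub>R s \<in> normal_cone C ?y"
    using n s by (intro normal_cone_scaleR x_in_C) auto
  then have "dist_set 0 {Df_adj c ?y u + n | n. n \<in> normal_cone C ?y} \<le> ereal (norm (Df_adj c ?y u + n /\<^sub>R s))"
    unfolding dist_set_def by (intro INF_lower2[of "Df_adj c ?y u + n /\<^sub>R s"]) auto
  with dist have "ereal \<eta> \<le> ereal (norm (Df_adj c ?y u + n /\<^sub>R s))"
    by (rule order_trans)
  then have "s * \<eta> \<le> s * norm (Df_adj c ?y u + n /\<^sub>R s)"
    using s by simp
  also have "\<dots> = norm (s *\<^sub>R (Df_adj c ?y u + n /\<^sub>R s))"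
    using s by simp
  also have "s *\<^sub>R (Df_adj c ?y u + n /\<^sub>R s) = s *\<^sub>R Df_adj c ?y u + n"
    using s by (simp add: scaleR_add_right)
  also have "norm \<dots> \<le> norm (?\<gamma> *\<^sub>R (grad f (x k) - \<xi> k + p) + s *\<^sub>R Df_adj c ?y u + n)
      + norm (?\<gamma> *\<^sub>R (grad f (x k) - \<xi> k + p))"
    using norm_triangle_ineq4[of "?\<gamma> *\<^sub>R (grad f (x k) - \<xi> k + p) + s *\<^sub>R Df_adj c ?y u + n"
        "?\<gamma> *\<^sub>R (grad f (x k) - \<xi> k + p)"] by simp
  also have "\<dots> \<le> ?\<gamma> * (c2 * (M_L + \<mu> 0 * Lsm (\<mu> 0))) + ?\<gamma> * (Mf + MP2 + MP1)"
  proof (rule add_mono)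
    have "step k / \<mu> k \<le> c2 * ?\<gamma>"
      using short \<mu>_pos[of k] by (simp add: field_simps)
    moreover have "\<mu> k * Lsm (\<mu> k) + L k \<le> M_L + \<mu> 0 * Lsm (\<mu> 0)"
      using \<mu>_times_Lsm_le[of k] L_le[of k] by simp
    moreover have "0 \<le> M_L + \<mu> 0 * Lsm (\<mu> 0)" "0 \<le> step k / \<mu> k"
      using M_L_pos \<mu>_pos[of 0] \<mu>_pos[of k] Lsm_pos[of "\<mu> 0"] by (auto simp: step_def)
    ultimately have "(\<mu> k * Lsm (\<mu> k) + L k) * (step k / \<mu> k) \<le> (M_L + \<mu> 0 * Lsm (\<mu> 0)) * (c2 * ?\<gamma>)"
      by (intro mult_mono) auto
    with res show "norm (?\<gamma> *\<^sub>R (grad f (x k) - \<xi> k + p) + s *\<^sub>R Df_adj c ?y u + n)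
        \<le> ?\<gamma> * (c2 * (M_L + \<mu> 0 * Lsm (\<mu> 0)))"
      by (simp add: mult_ac)
    have "norm (grad f (x k) - \<xi> k + p) \<le> norm (grad f (x k)) + norm (\<xi> k) + norm p"
      by (intro order_trans[OF norm_triangle_ineq] add_mono norm_triangle_ineq4 order_refl)
    also have "\<dots> \<le> Mf + MP2 + MP1"
      by (intro add_mono bounds(1) bounds(2)[OF x_in_C p] bounds(3)[OF x_in_C iteration(1)] x_in_C)
    finally show "norm (?\<gamma> *\<^sub>R (grad f (x k) - \<xi> k + p)) \<le> ?\<gamma> * (Mf + MP2 + MP1)"
      using inputs(6)[of "t k"] by (simp add: mult_left_mono)
  qed
  finally have "s * \<eta> \<le> ?\<gamma> * (Mf + MP1 + MP2 + c2 * (M_L + \<mu> 0 * Lsm (\<mu> 0)))"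
    by (simp add: algebra_simps)
  moreover have "1 / 2 * \<eta> < s * \<eta>"
    using s \<eta>(1) by (rule mult_strict_right_mono)
  ultimately show ?thesis by (simp add: algebra_simps)
qed

section \<open>Short steps without update\<close>

text \<open>
  With a short step, the absence of an update bounds \<open>hs\<close> from above at the new point. The witnesses are
  \<open>z = x k\<close>, the gradient of the smoothed \<open>h\<close> as \<open>u\<close>, and the slope divided by the weight as
  multiplier. Complementarity splits \<open>h = hs + (h - hs)\<close>: slope times \<open>hs\<close> is of order \<open>\<mu>\<close>
  by the slope inequality, and \<open>h - hs\<close> by the approximation property.
\<close>

lemma short_step_KKT:
  assumes feas: "t (Suc k) = t k" "step k \<le> c2 * \<mu> k * gh (t k)"
    and stat: "step k / \<mu> k * (M_L + \<mu> 0 * gh 0 * Lf + \<mu> 0 * Lsm (\<mu> 0)) \<le> \<epsilon>1 * gh (t k)"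
    and close: "step k \<le> \<epsilon>1 * \<epsilon>2"
    and subgr: "(\<alpha>31h + \<alpha>32h) * \<mu> k \<le> \<epsilon>2"
    and feas2: "(3 * (\<alpha>31\<phi> + \<alpha>32\<phi>) + pos_part \<alpha>31h) * \<mu> k \<le> \<epsilon>2"
    and compl: "(3 * (\<alpha>31\<phi> + \<alpha>32\<phi>) + pos_part \<alpha>31h + pos_part \<alpha>32h) * \<mu> k \<le> \<epsilon>2 * gh (t k)"
  shows "KKT_point C f P1 P2 c h \<epsilon>1 \<epsilon>2 (x (Suc k))"
proof -
  let ?y = "x (Suc k)" and ?\<gamma> = "gh (t k)" and ?m = "\<mu> k"
  define u where "u = grad (hs ?m) (c ?y)"
  define s where "s = slope ?m ?y"
  have m: "?m > 0" by (rule \<mu>_pos)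
  have \<gamma>: "?\<gamma> > 0" by (rule inputs)
  have s: "0 \<le> s" "s \<le> 1" using slope_bounds[OF m] by (auto simp: s_def)
  have hsle: "hs ?m (c ?y) \<le> 2 * (\<alpha>31\<phi> + \<alpha>32\<phi>) * ?m"
    using iteration(5)[of k] feas by (auto split: if_splits)
  define A where "A = (\<alpha>31\<phi> + \<alpha>32\<phi>) * ?m"
  have A: "A > 0" "hs ?m (c ?y) \<le> 2 * A" "3 * A + pos_part \<alpha>31h * ?m \<le> \<epsilon>2"
      "3 * A + pos_part \<alpha>31h * ?m + pos_part \<alpha>32h * ?m \<le> \<epsilon>2 * ?\<gamma>"
    using mult_pos_pos[OF \<alpha>_pos(6) m] hsle feas2 compl by (simp_all only: A_def distrib_right mult.assoc)
  have pp: "\<alpha>31h * ?m \<le> pos_part \<alpha>31h * ?m" "\<alpha>32h * ?m \<le> pos_part \<alpha>32h * ?m"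
    "0 \<le> pos_part \<alpha>31h * ?m" "0 \<le> pos_part \<alpha>32h * ?m"
    using m by (auto simp: pos_part_def intro: mult_right_mono)
  note hb = hs_bounds[OF m, of "c ?y"]

  have "h (c ?y) \<le> \<epsilon>2"
    using hb(1) A pp by linarith
  moreover have "u \<in> eps_subdiff \<epsilon>2 (\<lambda>y. ereal (h y)) (c ?y)"
    unfolding u_def by (rule smoothing_grad_eps_subgradient[OF hs m subgr])
  moreover have "\<bar>s / ?\<gamma> * h (c ?y)\<bar> \<le> \<epsilon>2"
  proof -
    have "\<bar>s * hs ?m (c ?y)\<bar> \<le> 2 * A"
      using smoothed_pos_part_slope_times_le[OF \<phi>s m hsle] by (simp only: s_def slope_def A_def mult.assoc)
    moreover have "\<bar>s * (h (c ?y) - hs ?m (c ?y))\<bar> \<le> 1 * (pos_part \<alpha>31h * ?m + pos_part \<alpha>32h * ?m)"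
      unfolding abs_mult using s hb pp by (intro mult_mono) (auto simp: abs_le_iff)
    ultimately have "\<bar>s * h (c ?y)\<bar> \<le> \<epsilon>2 * ?\<gamma>"
      using A abs_triangle_ineq[of "s * hs ?m (c ?y)" "s * (h (c ?y) - hs ?m (c ?y))"]
      by (simp add: right_diff_distrib)
    then show ?thesis using \<gamma> by (simp add: abs_mult field_simps)
  qed
  moreover have "norm (?y - x k) \<le> \<epsilon>1 * \<epsilon>2" using close by (simp add: step_def)
  moreover have "dist_set 0 {grad f ?y + p1 - p2 + (s / ?\<gamma>) *\<^sub>R Df_adj c ?y u + n | p1 p2 n.
      p1 \<in> subdiff (\<lambda>y. ereal (P1 y)) ?y \<and> p2 \<in> subdiff (\<lambda>y. ereal (P2 y)) (x k) \<and>
      n \<in> normal_cone C ?y} \<le> ereal \<epsilon>1" (is "dist_set 0 ?S \<le> _")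
  proof -
    obtain p n where p: "p \<in> subdiff (\<lambda>z. ereal (P1 z)) ?y" and n: "n \<in> normal_cone C ?y"
      and res: "norm (?\<gamma> *\<^sub>R (grad f (x k) - \<xi> k + p) + s *\<^sub>R Df_adj c ?y u + n)
        \<le> (?m * Lsm ?m + L k) * (step k / ?m)"
      unfolding s_def u_def by (rule residual)
    define v where "v = grad f ?y + p - \<xi> k + (s / ?\<gamma>) *\<^sub>R Df_adj c ?y u + n /\<^sub>R ?\<gamma>"
    have "n /\<^sub>R ?\<gamma> \<in> normal_cone C ?y"
      using n \<gamma> by (intro normal_cone_scaleR x_in_C) auto
    then have "v \<in> ?S" unfolding v_def using p iteration(1) by blast
    have "?\<gamma> *\<^sub>R v = (?\<gamma> *\<^sub>R (grad f (x k) - \<xi> k + p) + s *\<^sub>R Df_adj c ?y u + n)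
        + ?\<gamma> *\<^sub>R (grad f ?y - grad f (x k))"
      using \<gamma> by (simp add: v_def algebra_simps)
    then have "norm (?\<gamma> *\<^sub>R v) \<le> norm (?\<gamma> *\<^sub>R (grad f (x k) - \<xi> k + p) + s *\<^sub>R Df_adj c ?y u + n)
        + norm (?\<gamma> *\<^sub>R (grad f ?y - grad f (x k)))"
      by (simp only: norm_triangle_ineq)
    moreover have "norm (?\<gamma> *\<^sub>R (grad f ?y - grad f (x k))) \<le> ?\<gamma> * (Lf * step k)"
      using lipschitz_onD[OF f(3) x_in_C x_in_C, of "Suc k" k] \<gamma> by (simp add: dist_norm step_def)
    moreover have "?\<gamma> * (Lf * step k) = (?m * ?\<gamma> * Lf) * (step k / ?m)"
      using m by simp
    ultimately have "norm (?\<gamma> *\<^sub>R v) \<le> (?m * Lsm ?m + L k + ?m * ?\<gamma> * Lf) * (step k / ?m)"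
      using res unfolding distrib_right by linarith
    also have "\<dots> \<le> (\<mu> 0 * Lsm (\<mu> 0) + M_L + \<mu> 0 * gh 0 * Lf) * (step k / ?m)"
      using \<mu>_times_Lsm_le L_le gh_times_\<mu>_le f(2) m
      by (intro mult_right_mono add_mono) (auto simp: step_def)
    also have "\<dots> \<le> \<epsilon>1 * ?\<gamma>" using stat by (simp add: algebra_simps)
    finally have "norm v \<le> \<epsilon>1" using \<gamma> by simp
    then show ?thesis
      unfolding dist_set_def using \<open>v \<in> ?S\<close> by (intro INF_lower2[of v]) auto
  qed
  moreover have "s / ?\<gamma> \<ge> 0" using s \<gamma> by simp
  ultimately show ?thesis
    unfolding KKT_point_def using x_in_C[of k] x_in_C[of "Suc k"] by blast
qed

end

section \<open>Counting iterations\<close>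

text \<open>
  Among sets of at least a given number of indices up to \<open>n\<close>, the final segment carries
  the least weight: the indices in \<open>A - {m..n}\<close> lie below \<open>m\<close>, and there are at least as many of
  them as indices missing from \<open>{m..n}\<close>.
\<close>

lemma sum_le_sum_of_antimono:
  fixes w :: "nat \<Rightarrow> real"
  assumes w: "\<And>i j. i \<le> j \<Longrightarrow> w j \<le> w i" "\<And>i. w i \<ge> 0"
    and A: "A \<subseteq> {..n}" "card {m..n} \<le> card A"
  shows "sum w {m..n} \<le> sum w A"
proof -
  let ?B = "{m..n}"
  have fin: "finite A" using A(1) finite_subset by blast
  have "card (?B \<inter> A) + card (?B - A) = card ?B" "card (A \<inter> ?B) + card (A - ?B) = card A"
    using fin by (simp_all only: card_Int_Diff[symmetric] finite_atLeastAtMost)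
  then have "card (?B - A) \<le> card (A - ?B)"
    using A(2) by (simp add: Int_commute)
  have "sum w (?B - A) \<le> real (card (?B - A)) * w m"
    by (rule sum_bounded_above) (simp add: w)
  also have "\<dots> \<le> real (card (A - ?B)) * w m"
    using \<open>card (?B - A) \<le> card (A - ?B)\<close> w(2) by (intro mult_right_mono) auto
  also have "\<dots> \<le> sum w (A - ?B)"
    by (rule sum_bounded_below) (use A(1) w(1) in auto)
  finally have "sum w (?B - A) \<le> sum w (A - ?B)" .
  moreover have "sum w ?B = sum w (?B \<inter> A) + sum w (?B - A)"
    by (rule sum.Int_Diff) simp
  moreover have "sum w A = sum w (A \<inter> ?B) + sum w (A - ?B)"
    by (rule sum.Int_Diff[OF fin])
  ultimately show ?thesis by (simp add: Int_commute)
qed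

context sESQM
begin

text \<open>
  The window starts \<open>T\<close> indices before \<open>m\<close> to make up for the at most \<open>T\<close> updates. If all other
  steps in the window had squared ratio above \<open>\<beta>\<close>, their weighted sum would exceed the bound given
  by the potential.
\<close>

lemma exists_short_nonupdating_step:
  assumes b: "\<And>y. y \<in> C \<Longrightarrow> b \<le> f y + P1 y - P2 y"
    and T: "\<And>k. t k \<le> T" "T \<le> m" and "m \<le> n" and "\<beta> \<ge> 0"
    and large: "2 * (potential b 0 + pos_part (pos_part \<alpha>31h + \<alpha>31\<phi>) * \<mu> 0) / c1 < \<beta> * sum \<mu> {m..n}"
  shows "\<exists>k. m - T \<le> k \<and> k \<le> n \<and> t (Suc k) = t k \<and> (step k / \<mu> k)\<^sup>2 \<le> \<beta>"
proof (rule ccontr)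
  assume contr: "\<not> ?thesis"
  define U where "U = {k. k < Suc n \<and> t (Suc k) \<noteq> t k}"
  define A where "A = {m - T..n} - U"
  have "finite U" by (simp add: U_def)
  have "card U \<le> T"
    using T(1)[of "Suc n"] unfolding t_eq_card[of "Suc n"] U_def .
  moreover have "card {m - T..n} - card U \<le> card A"
    unfolding A_def by (rule diff_card_le_card_Diff[OF \<open>finite U\<close>])
  ultimately have "card {m..n} \<le> card A"
    using T(2) \<open>m \<le> n\<close> by simp
  then have "sum \<mu> {m..n} \<le> sum \<mu> A"
    by (intro sum_le_sum_of_antimono \<mu>_antimono less_imp_le[OF \<mu>_pos]) (auto simp: A_def)
  then have "\<beta> * sum \<mu> {m..n} \<le> \<beta> * sum \<mu> A"
    using \<open>\<beta> \<ge> 0\<close> by (rule mult_left_mono)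
  also have "\<dots> = (\<Sum>k\<in>A. \<mu> k * \<beta>)"
    by (simp add: sum_distrib_left mult.commute)
  also have "\<dots> \<le> (\<Sum>k\<in>A. \<mu> k * (step k / \<mu> k)\<^sup>2)"
  proof (intro sum_mono mult_left_mono)
    fix k assume "k \<in> A"
    then have "m - T \<le> k" "k \<le> n" "t (Suc k) = t k" by (auto simp: A_def U_def)
    then show "\<beta> \<le> (step k / \<mu> k)\<^sup>2" using contr by force
  qed (rule less_imp_le[OF \<mu>_pos])
  also have "\<dots> \<le> (\<Sum>k<Suc n. \<mu> k * (step k / \<mu> k)\<^sup>2)"
    by (rule sum_mono2) (auto simp: A_def \<mu>_pos less_imp_le)
  also have "\<dots> \<le> 2 * (potential b 0 + pos_part (pos_part \<alpha>31h + \<alpha>31\<phi>) * \<mu> 0) / c1"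
    by (rule weighted_steps_summable[OF b])
  finally show False using large by simp
qed

end

theorem corollary3p1:
  fixes C :: "'a::euclidean_space set"
    and f P1 P2 :: "'a \<Rightarrow> real"
    and c :: "'a \<Rightarrow> 'b::euclidean_space"
    and h :: "'b \<Rightarrow> real"
    and hs :: "real \<Rightarrow> 'b \<Rightarrow> real"
    and \<phi>s :: "real \<Rightarrow> real \<Rightarrow> real"
    and Lf Lc Mc Mh :: real
    and \<alpha>1h \<alpha>2h \<alpha>31h \<alpha>32h \<alpha>3h \<alpha>4h \<alpha>1\<phi> \<alpha>2\<phi> \<alpha>31\<phi> \<alpha>32\<phi> \<alpha>3\<phi> \<alpha>4\<phi> :: real
    and \<alpha>1 \<alpha>2 \<alpha>31 \<alpha>4 :: real
    and Llow Lup c1 c2 :: real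
    and gh :: "nat \<Rightarrow> real"
    and x \<xi> :: "nat \<Rightarrow> 'a"
    and L0 L \<mu> :: "nat \<Rightarrow> real"
    and t :: "nat \<Rightarrow> nat"
    and Lsm :: "real \<Rightarrow> real"
    and M_gh M_L M_f M_P1 M_P2 M_1 M_2 M_3 M_4 \<eta>1 \<eta>\<gamma> Q0 :: real
    and mbar :: ereal
    and k0 M_t :: nat
    and S :: "nat \<Rightarrow> real"
    and \<epsilon>1 \<epsilon>2 :: real
    and K :: nat
  assumes problem: "standing_assms C f P1 P2 c h Lf Lc Mc Mh"
    and h_smoothing: "smoothing_approx h hs \<alpha>1h \<alpha>2h \<alpha>31h \<alpha>32h" "smoothing_monotone hs \<alpha>4h"
    and pos_smoothing: "smoothing_approx pos_part \<phi>s \<alpha>1\<phi> \<alpha>2\<phi> \<alpha>31\<phi> \<alpha>32\<phi>"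
      "smoothing_monotone \<phi>s \<alpha>4\<phi>"
    and \<alpha>3h: "\<alpha>3h = \<alpha>31h + \<alpha>32h"
    and \<alpha>3\<phi>: "\<alpha>3\<phi> = \<alpha>31\<phi> + \<alpha>32\<phi>"
    and \<alpha>1: "\<alpha>1 = \<alpha>1h + Mh\<^sup>2 * \<alpha>1\<phi>"
    and \<alpha>2: "\<alpha>2 = \<alpha>2h + Mh\<^sup>2 * \<alpha>2\<phi>"
    and \<alpha>31: "\<alpha>31 = pos_part \<alpha>31h + \<alpha>31\<phi>"
    and \<alpha>4: "\<alpha>4 = \<alpha>4h + \<alpha>4\<phi>"
    and Lsm: "Lsm = (\<lambda>m. Mh * Lc + \<alpha>1 * Mc\<^sup>2 + \<alpha>2 * Mc\<^sup>2 / m)"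
    and run: "sESQM_run C f P1 P2 c hs \<phi>s \<alpha>3\<phi> Llow Lup c1 c2 gh x \<xi> L0 L t \<mu>"
    and CQ: "\<forall>y\<in>C. h (c y) \<ge> 0 \<longrightarrow>
        0 \<notin> {v + n | v n. v \<in> limiting_subdiff (\<lambda>z. ereal (h (c z))) y \<and> n \<in> normal_cone C y}"
    and \<mu>: "\<forall>k. \<mu> k > 0" "\<forall>k. \<mu> (Suc k) \<le> \<mu> k" "\<mu> \<longlonglongrightarrow> 0"
    and S: "S = (\<lambda>n. \<Sum>k = nat \<lceil>real n / 2\<rceil>..n. \<mu> k)"
    and S_lim: "filterlim S at_top sequentially"
    and gh: "gh \<longlonglongrightarrow> 0" "M_gh > 1"
      "\<forall>k. 0 < gh (Suc k) \<and> gh (Suc k) < gh k \<and> gh k \<le> M_gh * gh (Suc k)"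
    and M_L: "M_L = max Lup (c1 + gh (t 0) * \<mu> 0 * Lf + \<mu> 0 * Lsm (\<mu> 0))"
    and M_f: "M_f = (SUP y\<in>C. norm (grad f y))"
    and M_P1: "M_P1 = Sup {norm v | v y. y \<in> C \<and> v \<in> subdiff (\<lambda>z. ereal (P1 z)) y}"
    and M_P2: "M_P2 = Sup {norm v | v y. y \<in> C \<and> v \<in> subdiff (\<lambda>z. ereal (P2 z)) y}"
    and M_1: "M_1 = M_L + \<mu> 0 * gh 0 * Lf + \<mu> 0 * Lsm (\<mu> 0)"
    and \<eta>1: "\<eta>1 > 0"
      "\<forall>y\<in>C. h (c y) \<ge> - \<eta>1 \<longrightarrow> (\<forall>u\<in>eps_subdiff \<eta>1 (\<lambda>z. ereal (h z)) (c y).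
         dist_set 0 {Df_adj c y u + n | n. n \<in> normal_cone C y} \<ge> ereal \<eta>1)"
    and k0: "k0 = (LEAST k. \<mu> k \<le> \<eta>1 / max \<alpha>3h (pos_part \<alpha>32h))"
    and \<eta>\<gamma>: "\<eta>\<gamma> = min (\<eta>1 / (2 * M_gh * (M_f + M_P1 + M_P2 + c2 * (M_L + \<mu> 0 * Lsm (\<mu> 0)))))
                     (gh (k0 + 1))"
    and M_t: "M_t = Max {j. gh j \<ge> \<eta>\<gamma>}"
    and mbar: "mbar = (INF y. objective C f P1 P2 y)"
    and Q0: "Q0 = gh (t 0) * real_of_ereal (objective C f P1 P2 (x 0) - mbar)
                  + \<phi>s (\<mu> 0) (hs (\<mu> 0) (c (x 0))) + \<alpha>4 * \<mu> 0"
    and M_2: "M_2 = 1 + 2 * (real M_t + 1) * (Q0 + pos_part \<alpha>31 * \<mu> 0) / c1"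
    and M_3: "M_3 = (3 * \<alpha>3\<phi> + pos_part \<alpha>31h + pos_part \<alpha>32h) / \<eta>\<gamma>"
    and M_4: "M_4 = Min {1 / \<alpha>3h, 1 / M_3, M_1 / \<eta>\<gamma>, 1 / (3 * \<alpha>3\<phi> + pos_part \<alpha>31h)}"
    and \<epsilon>: "\<epsilon>1 > 0" "\<epsilon>2 > 0"
    and K: "K \<ge> 2 * M_t"
      "inverse (S K) \<le> inverse M_2 * \<eta>\<gamma>\<^sup>2 * min (c2\<^sup>2) (inverse (M_1\<^sup>2) * \<epsilon>1\<^sup>2)"
      "\<mu> (nat \<lceil>real K / 2\<rceil> - M_t) \<le> M_4 * \<epsilon>2"
  shows "\<exists>k. nat \<lceil>real K / 2\<rceil> - M_t \<le> k \<and> k \<le> K \<and> KKT_point C f P1 P2 c h \<epsilon>1 \<epsilon>2 (x (Suc k))"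
proof -
  interpret R: sESQM C f P1 P2 c h hs \<phi>s Lf Lc Mc Mh \<alpha>1h \<alpha>2h \<alpha>31h \<alpha>32h \<alpha>4h
      \<alpha>1\<phi> \<alpha>2\<phi> \<alpha>31\<phi> \<alpha>32\<phi> \<alpha>4\<phi> Llow Lup c1 c2 gh x \<xi> L0 L \<mu> t
    using problem h_smoothing pos_smoothing run unfolding \<alpha>3\<phi> by unfold_locales
  let ?\<psi> = "\<lambda>y. f y + P1 y - P2 y"

  have "Lsm = R.Lsm"
    by (simp add: fun_eq_iff Lsm R.Lsm_def R.penalty_lip_def \<alpha>1 \<alpha>2 distrib_right)
  have "M_L = R.M_L"
    by (simp add: M_L R.M_L_def R.inputs(7) \<open>Lsm = R.Lsm\<close>)
  have Lsm_pos: "\<mu> 0 * R.Lsm (\<mu> 0) > 0"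
    using R.Lsm_pos R.\<mu>_pos by simp
  have \<alpha>3_pos: "\<alpha>3h > 0" "\<alpha>3\<phi> > 0"
    using R.\<alpha>_pos by (auto simp: \<alpha>3h \<alpha>3\<phi>)
  have M_1_pos: "M_1 > 0"
    using R.M_L_pos Lsm_pos R.\<mu>_pos[of 0] R.inputs(6)[of 0] R.f(2)
    by (simp add: M_1 \<open>M_L = R.M_L\<close> \<open>Lsm = R.Lsm\<close> add_pos_pos)

  have bound_f: "norm (grad f y) \<le> M_f" if "y \<in> C" for y
    unfolding M_f
  proof (rule cSUP_upper[OF that])
    have "continuous_on C (\<lambda>y. norm (grad f y))"
      by (intro continuous_on_norm lipschitz_on_continuous_on[OF R.f(3)])
    then show "bdd_above ((\<lambda>y. norm (grad f y)) ` C)"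
      by (intro bounded_imp_bdd_above compact_imp_bounded compact_continuous_image R.C)
  qed
  have bound_P1: "norm v \<le> M_P1" if "y \<in> C" "v \<in> subdiff (\<lambda>z. ereal (P1 z)) y" for y v
    unfolding M_P1 using that by (intro cSup_upper subdiff_bounded_on_compact R.P1 R.C) blast
  have bound_P2: "norm v \<le> M_P2" if "y \<in> C" "v \<in> subdiff (\<lambda>z. ereal (P2 z)) y" for y v
    unfolding M_P2 using that by (intro cSup_upper subdiff_bounded_on_compact R.P2 R.C) blast

  define M where "M = M_f + M_P1 + M_P2 + c2 * (R.M_L + \<mu> 0 * R.Lsm (\<mu> 0))"
  have "M > 0"
  proof -
    \<comment> \<open>The sign of a supremum of norms is known only once the set is seen to be nonempty.\<close>
    obtain p where "p \<in> subdiff (\<lambda>z. ereal (P1 z)) (x (Suc 0))"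
      by (rule R.residual)
    then have "M_P1 \<ge> 0"
      using bound_P1[OF R.x_in_C] norm_ge_zero order_trans by blast
    moreover have "M_P2 \<ge> 0"
      using bound_P2[OF R.x_in_C R.iteration(1)] norm_ge_zero order_trans by blast
    moreover have "M_f \<ge> 0"
      using bound_f[OF R.inputs(1)] norm_ge_zero order_trans by blast
    moreover have "c2 * (R.M_L + \<mu> 0 * R.Lsm (\<mu> 0)) > 0"
      using R.inputs(5) R.M_L_pos Lsm_pos by simp
    ultimately show ?thesis unfolding M_def by linarith
  qed
  have \<eta>\<gamma>_eq: "\<eta>\<gamma> = min (\<eta>1 / (2 * M_gh * M)) (gh (k0 + 1))"
    by (simp add: \<eta>\<gamma> M_def \<open>Lsm = R.Lsm\<close> \<open>M_L = R.M_L\<close>)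
  have \<eta>\<gamma>_pos: "\<eta>\<gamma> > 0"
    using \<eta>1(1) gh(2) \<open>M > 0\<close> R.inputs(6) by (simp add: \<eta>\<gamma>_eq)

  have small: "\<alpha>3h * \<mu> k \<le> \<eta>1 \<and> pos_part \<alpha>32h * \<mu> k \<le> \<eta>1" if "k \<ge> k0" for k
  proof -
    define r where "r = max \<alpha>3h (pos_part \<alpha>32h)"
    have "r > 0" using \<alpha>3_pos(1) by (simp add: r_def)
    then have "\<forall>\<^sub>F k in sequentially. \<mu> k < \<eta>1 / r"
      using order_tendstoD(2)[OF \<mu>(3), of "\<eta>1 / r"] \<eta>1(1) by simp
    then obtain j where "\<mu> j \<le> \<eta>1 / r"
      by (auto simp: eventually_sequentially intro: less_imp_le)
    then have "\<mu> k0 \<le> \<eta>1 / r"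
      unfolding k0 r_def by (rule LeastI)
    then have "\<mu> k \<le> \<eta>1 / r"
      using R.\<mu>_antimono[OF that] by linarith
    then have "r * \<mu> k \<le> \<eta>1" using \<open>r > 0\<close> by (simp add: field_simps)
    moreover have "\<alpha>3h * \<mu> k \<le> r * \<mu> k" "pos_part \<alpha>32h * \<mu> k \<le> r * \<mu> k"
      using R.\<mu>_pos[of k] by (auto simp: r_def intro: mult_right_mono)
    ultimately show ?thesis by linarith
  qed

  have weight_ge: "gh (t k) \<ge> \<eta>\<gamma>" for k
  proof (induction k)
    case 0
    have "\<eta>\<gamma> \<le> gh (k0 + 1)" by (simp add: \<eta>\<gamma>_eq)
    also have "\<dots> \<le> gh (t 0)" by (intro R.gh_antimono) (simp add: R.inputs)
    finally show ?case .
  next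
    case (Suc k)
    \<comment> \<open>Up to iteration \<open>k0\<close> too few updates can have happened to get below
      \<open>gh (k0 + 1)\<close>; from then on the smoothing error is within \<open>\<eta>1\<close>, and
      \<open>M_gh\<close> turns the bound on the weight before an update into one after it.\<close>
    consider "t (Suc k) = t k" | "k < k0" | "t (Suc k) \<noteq> t k" "k \<ge> k0" by linarith
    then show ?case
    proof cases
      case 1
      with Suc show ?thesis by simp
    next
      case 2
      have "\<eta>\<gamma> \<le> gh (k0 + 1)" by (simp add: \<eta>\<gamma>_eq)
      also have "\<dots> \<le> gh (t (Suc k))"
        using 2 R.t_le[of "Suc k"] by (intro R.gh_antimono) simp
      finally show ?thesis .
    next
      case 3
      have "\<eta>1 < gh (t k) * (2 * M)"
        unfolding M_def
        by (rule R.penalty_update_bound[OF bound_f bound_P1 bound_P2 \<eta>1(1) _ _ _ 3(1)])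
          (use \<eta>1(2) small[OF 3(2)] in \<open>auto simp: \<alpha>3h\<close>)
      also have "\<dots> \<le> M_gh * gh (Suc (t k)) * (2 * M)"
        using gh(3) \<open>M > 0\<close> by (intro mult_right_mono) auto
      finally have "\<eta>1 < gh (t (Suc k)) * (2 * M_gh * M)"
        using R.t_Suc[of k] 3(1) by (simp add: mult_ac)
      then have "\<eta>1 / (2 * M_gh * M) < gh (t (Suc k))"
        using gh(2) \<open>M > 0\<close> by (simp add: pos_divide_less_eq)
      then show ?thesis by (simp add: \<eta>\<gamma>_eq)
    qed
  qed

  have t_le: "t k \<le> M_t" for k
  proof -
    have "\<forall>\<^sub>F j in sequentially. gh j < \<eta>\<gamma>"
      by (rule order_tendstoD(2)[OF gh(1) \<eta>\<gamma>_pos])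
    then obtain N where "\<And>j. j \<ge> N \<Longrightarrow> gh j < \<eta>\<gamma>"
      by (auto simp: eventually_sequentially)
    then have "{j. gh j \<ge> \<eta>\<gamma>} \<subseteq> {..N}"
      by (auto simp: not_less[symmetric])
    then have "finite {j. gh j \<ge> \<eta>\<gamma>}" by (rule finite_subset) simp
    then show ?thesis unfolding M_t using weight_ge by (intro Max_ge) auto
  qed

  obtain b where b: "mbar = ereal b" "\<And>y. y \<in> C \<Longrightarrow> b \<le> ?\<psi> y"
  proof -
    have "continuous_on C f"
      using R.f(1) by (intro continuous_at_imp_continuous_on ballI differentiable_imp_continuous_within)
    moreover have "continuous_on C P1" "continuous_on C P2"
      using convex_on_continuous[OF open_UNIV R.P1] convex_on_continuous[OF open_UNIV R.P2]
      by (auto intro: continuous_on_subset)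
    ultimately have "continuous_on C ?\<psi>"
      by (intro continuous_on_add continuous_on_diff)
    then obtain y0 where y0: "y0 \<in> C" "\<And>y. y \<in> C \<Longrightarrow> ?\<psi> y0 \<le> ?\<psi> y"
      using continuous_attains_inf[OF R.C(1), of ?\<psi>] R.inputs(1) by auto
    \<comment> \<open>The objective is infinite off \<open>C\<close>, so the minimum of \<open>\<psi>\<close>
      on \<open>C\<close> is the infimum over the whole space.\<close>
    have "mbar = ereal (?\<psi> y0)"
      unfolding mbar
    proof (rule antisym)
      show "(INF y. objective C f P1 P2 y) \<le> ereal (?\<psi> y0)"
        using y0(1) by (intro INF_lower2[of y0]) (auto simp: objective_def delta_def)
      show "ereal (?\<psi> y0) \<le> (INF y. objective C f P1 P2 y)"
        using y0(2) by (intro INF_greatest) (auto simp: objective_def delta_def)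
    qed
    then show ?thesis using that y0(2) by blast
  qed

  define W where "W = Q0 + pos_part \<alpha>31 * \<mu> 0"
  have W: "W = R.potential b 0 + pos_part (pos_part \<alpha>31h + \<alpha>31\<phi>) * \<mu> 0"
    using R.inputs(1)
    by (simp add: W_def Q0 b(1) objective_def delta_def R.potential_def R.gs_def \<alpha>31 \<alpha>4)
  have "W \<ge> 0"
    using R.potential_ge[of b 0, OF b(2)] by (simp add: W)

  define m where "m = nat \<lceil>real K / 2\<rceil>"
  have m: "M_t \<le> m" "m \<le> K"
    using K(1) unfolding m_def by linarith+
  define \<beta> where "\<beta> = \<eta>\<gamma>\<^sup>2 * min (c2\<^sup>2) (inverse (M_1\<^sup>2) * \<epsilon>1\<^sup>2)"
  have "\<beta> \<ge> 0" by (simp add: \<beta>_def)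
  have S_K: "S K = sum \<mu> {m..K}" "S K > 0"
    using m(2) R.\<mu>_pos by (auto simp: S m_def intro!: sum_pos)
  have "M_2 \<ge> 1 + 2 * W / c1"
  proof -
    have "2 * 1 * W / c1 \<le> 2 * (real M_t + 1) * W / c1"
      using \<open>W \<ge> 0\<close> R.inputs(4) by (intro divide_right_mono mult_right_mono) auto
    then show ?thesis by (simp add: M_2 W_def)
  qed
  moreover have "2 * W / c1 \<ge> 0" using \<open>W \<ge> 0\<close> R.inputs(4) by simp
  ultimately have "M_2 > 0" "2 * W / c1 < M_2" by linarith+
  have "inverse (S K) \<le> inverse M_2 * \<beta>"
    using K(2) by (simp add: \<beta>_def mult.assoc)
  then have "M_2 \<le> \<beta> * S K"
    using \<open>M_2 > 0\<close> S_K(2) by (simp add: field_simps)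
  with \<open>2 * W / c1 < M_2\<close>
  have "2 * (R.potential b 0 + pos_part (pos_part \<alpha>31h + \<alpha>31\<phi>) * \<mu> 0) / c1 < \<beta> * sum \<mu> {m..K}"
    by (simp only: W S_K)
  from R.exists_short_nonupdating_step[OF b(2) t_le m \<open>\<beta> \<ge> 0\<close> this]
  obtain k where k: "m - M_t \<le> k" "k \<le> K" "t (Suc k) = t k" "(R.step k / \<mu> k)\<^sup>2 \<le> \<beta>"
    by blast

  let ?r = "R.step k / \<mu> k"
  have r_nonneg: "?r \<ge> 0" using R.\<mu>_pos[of k] by (simp add: R.step_def)
  have "\<beta> \<le> \<eta>\<gamma>\<^sup>2 * c2\<^sup>2" "\<beta> \<le> \<eta>\<gamma>\<^sup>2 * (inverse (M_1\<^sup>2) * \<epsilon>1\<^sup>2)"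
    unfolding \<beta>_def by (intro mult_left_mono min.cobounded1 min.cobounded2 zero_le_power2)+
  moreover have "\<eta>\<gamma>\<^sup>2 * c2\<^sup>2 = (\<eta>\<gamma> * c2)\<^sup>2"
    by (simp add: power_mult_distrib)
  moreover have "\<eta>\<gamma>\<^sup>2 * (inverse (M_1\<^sup>2) * \<epsilon>1\<^sup>2) = (\<eta>\<gamma> * (\<epsilon>1 / M_1))\<^sup>2"
    using M_1_pos by (simp add: field_simps)
  ultimately have "?r\<^sup>2 \<le> (\<eta>\<gamma> * c2)\<^sup>2" "?r\<^sup>2 \<le> (\<eta>\<gamma> * (\<epsilon>1 / M_1))\<^sup>2"
    using k(4) by linarith+
  then have r: "?r \<le> \<eta>\<gamma> * c2" "?r \<le> \<eta>\<gamma> * (\<epsilon>1 / M_1)"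
    using \<eta>\<gamma>_pos R.inputs(5) M_1_pos \<epsilon> by (auto intro: power2_le_imp_le)
  have step_eq: "R.step k = \<mu> k * ?r" using R.\<mu>_pos[of k] by simp

  define D where "D = 3 * \<alpha>3\<phi> + pos_part \<alpha>31h"
  have D: "D > 0" "D + pos_part \<alpha>32h > 0"
    using \<alpha>3_pos by (auto simp: D_def pos_part_def add_pos_nonneg)
  have "\<mu> k \<le> M_4 * \<epsilon>2"
    using R.\<mu>_antimono[OF k(1)] K(3) by (simp add: m_def)
  moreover have "M_4 \<le> 1 / \<alpha>3h" "M_4 \<le> \<eta>\<gamma> / (D + pos_part \<alpha>32h)" "M_4 \<le> M_1 / \<eta>\<gamma>" "M_4 \<le> 1 / D"
    by (auto simp: M_4 M_3 D_def)
  ultimately have \<mu>_le: "\<mu> k \<le> 1 / \<alpha>3h * \<epsilon>2" "\<mu> k \<le> \<eta>\<gamma> / (D + pos_part \<alpha>32h) * \<epsilon>2"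
      "\<mu> k \<le> M_1 / \<eta>\<gamma> * \<epsilon>2" "\<mu> k \<le> 1 / D * \<epsilon>2"
    using \<epsilon>(2) by (meson less_imp_le mult_right_mono order_trans)+

  have "KKT_point C f P1 P2 c h \<epsilon>1 \<epsilon>2 (x (Suc k))"
  proof (rule R.short_step_KKT[OF k(3)])
    have "?r \<le> gh (t k) * c2"
      using r(1) mult_right_mono[OF weight_ge[of k], of c2] R.inputs(5) by linarith
    then have "\<mu> k * ?r \<le> \<mu> k * (gh (t k) * c2)"
      using R.\<mu>_pos[of k] by (intro mult_left_mono) auto
    then show "R.step k \<le> c2 * \<mu> k * gh (t k)"
      unfolding step_eq[symmetric] by (simp add: mult_ac)
    have "?r * M_1 \<le> \<epsilon>1 * \<eta>\<gamma>"
      using mult_right_mono[OF r(2), of M_1] M_1_pos by (simp add: mult_ac)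
    also have "\<dots> \<le> \<epsilon>1 * gh (t k)"
      using weight_ge \<epsilon>(1) by (intro mult_left_mono) auto
    finally show "?r * (R.M_L + \<mu> 0 * gh 0 * Lf + \<mu> 0 * R.Lsm (\<mu> 0)) \<le> \<epsilon>1 * gh (t k)"
      by (simp add: M_1 \<open>M_L = R.M_L\<close> \<open>Lsm = R.Lsm\<close>)
    have "\<mu> k * ?r \<le> (M_1 / \<eta>\<gamma> * \<epsilon>2) * (\<eta>\<gamma> * (\<epsilon>1 / M_1))"
      using \<mu>_le(3) r(2) r_nonneg M_1_pos \<eta>\<gamma>_pos \<epsilon> by (intro mult_mono) auto
    also have "\<dots> = \<epsilon>1 * \<epsilon>2"
      using M_1_pos \<eta>\<gamma>_pos by simp
    finally show "R.step k \<le> \<epsilon>1 * \<epsilon>2"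
      unfolding step_eq[symmetric] .
    show "(\<alpha>31h + \<alpha>32h) * \<mu> k \<le> \<epsilon>2"
      using \<mu>_le(1) \<alpha>3_pos(1) by (simp add: \<alpha>3h[symmetric] field_simps)
    show "(3 * (\<alpha>31\<phi> + \<alpha>32\<phi>) + pos_part \<alpha>31h) * \<mu> k \<le> \<epsilon>2"
      using \<mu>_le(4) D(1) unfolding \<alpha>3\<phi>[symmetric] D_def[symmetric] by (simp add: field_simps)
    have "(D + pos_part \<alpha>32h) * \<mu> k \<le> \<eta>\<gamma> * \<epsilon>2"
      using \<mu>_le(2) D(2) by (simp add: pos_le_divide_eq mult.commute)
    also have "\<dots> \<le> \<epsilon>2 * gh (t k)"
      using weight_ge[of k] \<epsilon>(2) by (simp add: mult.commute)
    finally show "(3 * (\<alpha>31\<phi> + \<alpha>32\<phi>) + pos_part \<alpha>31h + pos_part \<alpha>32h) * \<mu> k \<le> \<epsilon>2 * gh (t k)"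
      unfolding \<alpha>3\<phi>[symmetric] D_def[symmetric] .
  qed
  then show ?thesis using k(1,2) unfolding m_def by blast
qed

end
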